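(* Let $k$ be a positive integer and let $G$ be a graph of order $n\geqslant 2k+1$. If $G$ contains none of the cycles $C_3,C_5,\ldots,C_{2k+1}$ as a subgraph, then $$\lambda_1^{2k}+\lambda_2^{2k}\leqslant \frac{\operatorname{Tr}(A^{2k}(G))}{2}=\frac{\beta_{2k}(G)}{2},$$ and equality holds if and only if $G$ is a blow-up of $H$ for some $H\in\{P_2\cup K_1,\ 2P_2\cup K_1,\ P_4\cup K_1,\ P_5\cup K_1\}$.
   Context: All graphs are finite, simple and undirected. $A(G)$ is the adjacency matrix of $G$, with eigenvalues $\lambda_1\geqslant\lambda_2\geqslant\cdots\geqslant\lambda_n$; $\operatorname{Tr}$ denotes the trace. $\beta_{t}(G)$ is the number of closed walks of length $t$ in $G$. $P_m$ is the path on $m$ vertices, $K_m$ the complete graph on $m$ vertices, $C_m$ the cycle on $m$ vertices; $H_1\cup H_2$ denotes the disjoint union and $tP_m$ the disjoint union of $t$ copies of $P_m$. A blow-up of a graph $H$ is a graph obtained from $H$ by replacing each vertex $v$ of $H$ with a stable (independent) set $I_v$ and joining every vertex of $I_u$ to every vertex of $I_v$ whenever $uv$ is an edge of $H$ (and no other edges). *)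

theory Defs
  imports
    "Graph_Theory.Graph_Theory"
    "Jordan_Normal_Form.Char_Poly"
begin

text \<open>
  A finite simple undirected graph is a \<^locale>\<open>pair_graph\<close>: a finite, loopfree, symmetric digraph
  without parallel arcs, in which an undirected edge \<open>uv\<close> is the pair of arcs \<open>(u, v)\<close>, \<open>(v, u)\<close>.
\<close>

definition path_graph :: "nat \<Rightarrow> nat pair_pre_digraph" where
  "path_graph m = \<lparr> pverts = {..<m},
     parcs = {(i, j). i < m \<and> j < m \<and> (j = Suc i \<or> i = Suc j)} \<rparr>"

definition complete_graph :: "nat \<Rightarrow> nat pair_pre_digraph" where
  "complete_graph m = \<lparr> pverts = {..<m}, parcs = {(i, j). i < m \<and> j < m \<and> i \<noteq> j} \<rparr>"

text \<open>Only meaningful for \<open>m \<ge> 3\<close>.\<close>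

definition cycle_graph :: "nat \<Rightarrow> nat pair_pre_digraph" where
  "cycle_graph m = \<lparr> pverts = {..<m},
     parcs = {(i, j). i < m \<and> j < m \<and> (j = Suc i mod m \<or> i = Suc j mod m)} \<rparr>"

definition disjoint_union ::
    "'a pair_pre_digraph \<Rightarrow> 'b pair_pre_digraph \<Rightarrow> ('a + 'b) pair_pre_digraph" where
  "disjoint_union H1 H2 = \<lparr> pverts = pverts H1 <+> pverts H2,
     parcs = {(Inl u, Inl v) | u v. (u, v) \<in> parcs H1} \<union> {(Inr u, Inr v) | u v. (u, v) \<in> parcs H2} \<rparr>"

definition disjoint_copies :: "nat \<Rightarrow> 'a pair_pre_digraph \<Rightarrow> (nat \<times> 'a) pair_pre_digraph" where
  "disjoint_copies t H = \<lparr> pverts = {..<t} \<times> pverts H,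
     parcs = {((c, u), (c, v)) | c u v. c < t \<and> (u, v) \<in> parcs H} \<rparr>"

text \<open>Subgraphs are not required to be induced.\<close>

definition contains_subgraph :: "'a pair_pre_digraph \<Rightarrow> 'b pair_pre_digraph \<Rightarrow> bool" where
  "contains_subgraph G H \<longleftrightarrow>
     (\<exists>S :: 'a pair_pre_digraph. subgraph (with_proj S) (with_proj G) \<and>
        digraph_iso (with_proj H) (with_proj S))"

text \<open>
  \<open>I v\<close> is the stable set replacing the vertex \<open>v\<close>; it is allowed to be empty. (A complete bipartite
  graph without isolated vertices is thus a blow-up of \<open>P\<^sub>2 \<union> K\<^sub>1\<close>, with the part of \<open>K\<^sub>1\<close> empty.)
\<close>

definition is_blow_up :: "'a pair_pre_digraph \<Rightarrow> 'b pair_pre_digraph \<Rightarrow> bool" where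
  "is_blow_up G H \<longleftrightarrow>
     (\<exists>I :: 'b \<Rightarrow> 'a set.
        disjoint_family_on I (pverts H) \<and>
        pverts G = (\<Union>v \<in> pverts H. I v) \<and>
        parcs G = (\<Union>(u, v) \<in> parcs H. I u \<times> I v))"

text \<open>
  The number of closed walks of length \<open>t\<close>. A walk is its start vertex together with its list of
  arcs, so closed walks with different start vertices are counted separately.
\<close>

definition closed_walks :: "nat \<Rightarrow> 'a pair_pre_digraph \<Rightarrow> nat" where
  "closed_walks t G = card {(u, p). pre_digraph.awalk (with_proj G) u p u \<and> length p = t}"

text \<open>The list \<open>vs\<close> enumerates the vertices and fixes the order of the rows and columns.\<close>

definition adjacency_matrix :: "'a pair_pre_digraph \<Rightarrow> 'a list \<Rightarrow> real mat" where
  "adjacency_matrix G vs =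
     mat (length vs) (length vs) (\<lambda>(i, j). if (vs ! i, vs ! j) \<in> parcs G then 1 else 0)"

definition trace_mat :: "'a :: comm_monoid_add mat \<Rightarrow> 'a" where
  "trace_mat A = (\<Sum>i < dim_row A. A $$ (i, i))"

text \<open>
  The real eigenvalues in non-increasing order, with algebraic multiplicity. For a symmetric matrix
  the characteristic polynomial splits over the reals, so the list has length \<open>dim_row A\<close>.
\<close>

definition eigenvalue_list :: "real mat \<Rightarrow> real list" where
  "eigenvalue_list A = rev (sorted_list_of_multiset (proots (char_poly A)))"

text \<open>The index \<open>i\<close> starts at 1.\<close>

definition nth_eigenvalue :: "real mat \<Rightarrow> nat \<Rightarrow> real" where
  "nth_eigenvalue A i = eigenvalue_list A ! (i - 1)"

end

theory Submission
  imports Defs "Jordan_Normal_Form.Schur_Decomposition"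
begin

text \<open>
  Let \<open>p = 2k\<close>. Without short odd cycles there are no closed walks of odd length up to \<open>p + 1\<close>, so the
  eigenvalues satisfy \<open>\<Sum>\<lambda>\<^sub>i = \<Sum>\<lambda>\<^sub>i\<^sup>3 = \<Sum>\<lambda>\<^sub>i\<^sup>p\<^sup>+\<^sup>1 = 0\<close>; also \<open>-\<lambda>\<^sub>i \<le> \<lambda>\<^sub>1\<close>, since all odd traces are
  nonnegative. If \<open>\<lambda>\<^sub>1\<^sup>p + \<lambda>\<^sub>2\<^sup>p\<close> is at least half of the trace, then the numbers \<open>-\<lambda>\<^sub>i\<close> with \<open>i \<ge> 3\<close> have
  \<open>p\<close>-th powers majorised by \<open>\<lambda>\<^sub>1\<^sup>p, \<lambda>\<^sub>2\<^sup>p\<close> but \<open>(p+1)\<close>-st powers with the same sum, and strict convexity leaves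
  at most two of them nonzero. Conversely, if at most four eigenvalues are nonzero, the vanishing of
  the sum and of the sum of cubes makes the spectrum \<open>\<plusminus>\<lambda>\<^sub>1, \<plusminus>\<lambda>\<^sub>2, 0, \<dots>\<close>, which gives equality.

  Hence equality means rank at most 4. In that case all odd traces vanish, so the graph is bipartite, and the
  3 by 3 minors of its biadjacency matrix vanish; among three distinct nonempty neighbourhoods one is
  then the disjoint union of the other two. So the nonempty neighbourhoods lie in some \<open>{S, T}\<close>
  or in some \<open>{S, T, S \<union> T}\<close> with \<open>S\<close> and \<open>T\<close> disjoint, and in both cases the graph is a blow-up of \<open>P\<^sub>5 \<union> K\<^sub>1\<close>.
  As parts may be empty and the other three graphs are induced subgraphs of \<open>P\<^sub>5 \<union> K\<^sub>1\<close>, this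
  covers all four cases, and the adjacency matrix of \<open>P\<^sub>5\<close> has rank 4.
\<close>

section \<open>Power sums\<close>

text \<open>Weighted AM-GM for \<open>x ^ Suc p\<close> with weight \<open>p\<close> and
  \<open>y ^ Suc p\<close> with weight 1. The induction step adds
  \<open>(p + 1) * x ^ p * (x - y)\<^sup>2 \<ge> 0\<close> to \<open>y\<close> times the previous
  inequality.\<close>

lemma weighted_am_gm_power:
  fixes x y :: real
  assumes "0 \<le> x" "0 \<le> y"
  shows "(real p + 1) * (y * x ^ p) \<le> real p * x ^ Suc p + y ^ Suc p"
proof (induction p)
  case (Suc p)
  have "0 \<le> (real p + 1) * x ^ p * (x - y)\<^sup>2" using assms by simp
  moreover have "y * ((real p + 1) * (y * x ^ p)) \<le> y * (real p * x ^ Suc p + y ^ Suc p)"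
    using Suc assms by (intro mult_left_mono)
  ultimately show ?case by (simp add: algebra_simps power2_eq_square)
qed simp

text \<open>Spreading two numbers apart at a fixed sum of \<open>p\<close>-th powers cannot decrease
  the sum of the next powers, because \<open>s ^ ((p + 1) / p)\<close> is convex in
  \<open>s\<close>. The previous lemma supplies the tangent inequalities at both numbers without
  fractional exponents.\<close>

lemma power_sum_two_terms_mono:
  fixes a b c z :: real
  assumes "0 < p" "0 \<le> b" "b \<le> c" "c \<le> a" "b \<le> z" "z \<le> a" "c ^ p + z ^ p = a ^ p + b ^ p"
  shows "c ^ Suc p + z ^ Suc p \<le> a ^ Suc p + b ^ Suc p"
proof -
  have *: "M ^ Suc p + m ^ Suc p \<le> a ^ Suc p + b ^ Suc p"
    if "b \<le> m" "m \<le> M" "M \<le> a" "M ^ p + m ^ p = a ^ p + b ^ p" for m M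
  proof -
    have bm: "b ^ p \<le> m ^ p"
      using that assms(2) by (auto intro!: power_mono)
    have "(real p + 1) * (M * (a ^ p - M ^ p)) \<le> real p * (a ^ Suc p - M ^ Suc p)"
      using weighted_am_gm_power[of a M p] that assms(2) by (simp add: algebra_simps)
    have eq: "m ^ p - b ^ p = a ^ p - M ^ p" using that by simp
    have "real p * (m ^ Suc p - b ^ Suc p) \<le> (real p + 1) * (m * (m ^ p - b ^ p))"
      using weighted_am_gm_power[of b m p] that assms(2) by (simp add: algebra_simps)
    also have "\<dots> \<le> (real p + 1) * (M * (m ^ p - b ^ p))"
      using bm that by (intro mult_left_mono mult_right_mono) auto
    also have "\<dots> = (real p + 1) * (M * (a ^ p - M ^ p))" by (simp only: eq)
    also have "\<dots> \<le> real p * (a ^ Suc p - M ^ Suc p)" by fact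
    finally have "real p * (m ^ Suc p - b ^ Suc p) \<le> real p * (a ^ Suc p - M ^ Suc p)" .
    then show ?thesis using assms(1) by (subst (asm) mult_le_cancel_left_pos) auto
  qed
  show ?thesis
    using *[of c z] *[of z c] assms by (cases "c \<le> z") (auto simp: add.commute)
qed

text \<open>Each nonzero entry contributes the same positive amount \<open>z ^ p\<close>, so the
  bound on the sum counts these entries.\<close>

lemma card_nonzero_le_if_vals:
  fixes y :: "'i \<Rightarrow> real" and z :: real
  assumes "finite J" "even p" "0 < p" "z \<noteq> 0" "(\<Sum>i\<in>J. y i ^ p) \<le> m * z ^ p"
    and "\<And>i. i \<in> J \<Longrightarrow> y i = 0 \<or> y i = z"
  shows "card {i\<in>J. y i \<noteq> 0} \<le> m"
proof -
  have "(\<Sum>i\<in>J. y i ^ p) = (\<Sum>i\<in>{i\<in>J. y i \<noteq> 0}. z ^ p)"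
    using assms by (intro sum.mono_neutral_cong_right) auto
  then have "card {i\<in>J. y i \<noteq> 0} * z ^ p \<le> m * z ^ p" using assms by simp
  moreover have "z ^ p > 0" using assms by (simp add: zero_less_power_eq)
  ultimately show ?thesis by simp
qed

text \<open>The equality case of the majorisation inequality \<open>\<parallel>y\<parallel>\<^sub>p\<^sub>+\<^sub>1 \<le> \<parallel>(a, b)\<parallel>\<^sub>p\<^sub>+\<^sub>1\<close>: split off the
  largest entry \<open>c\<close> and replace the others by a single \<open>z\<close> carrying the rest of the \<open>p\<close>-th power sum.\<close>
lemma card_nonzero_le_2_if_power_sums:
  fixes y :: "'i \<Rightarrow> real" and a b :: real
  assumes fin: "finite J" and ev: "even p" and p: "0 < p" and b: "0 \<le> b" and ab: "b \<le> a"
    and le: "\<And>i. i \<in> J \<Longrightarrow> y i \<le> a"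
    and eq: "(\<Sum>i\<in>J. y i ^ Suc p) = a ^ Suc p + b ^ Suc p"
    and sum: "(\<Sum>i\<in>J. y i ^ p) \<le> a ^ p + b ^ p"
  shows "card {i\<in>J. y i \<noteq> 0} \<le> 2"
proof (cases "\<forall>i\<in>J. y i \<le> b")
  \<comment> \<open>The terms \<open>y i ^ p * (b - y i)\<close> are nonnegative and their sum is at
    most \<open>- (a ^ p * (a - b))\<close>. Hence all of them vanish and
    \<open>a = b\<close>.\<close>
  case True
  have nn: "0 \<le> y i ^ p * (b - y i)" if "i \<in> J" for i
    using True that ev by (simp add: zero_le_power_eq)
  have S: "(\<Sum>i\<in>J. y i ^ p * (b - y i)) = b * (\<Sum>i\<in>J. y i ^ p) - (a ^ Suc p + b ^ Suc p)"
    unfolding eq[symmetric] by (simp add: sum_distrib_left sum_subtractf[symmetric] algebra_simps)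
  also have "\<dots> \<le> b * (a ^ p + b ^ p) - (a ^ Suc p + b ^ Suc p)"
    using sum b by (simp add: mult_left_mono)
  also have "\<dots> = - (a ^ p * (a - b))" by (simp add: algebra_simps)
  finally have S2: "(\<Sum>i\<in>J. y i ^ p * (b - y i)) \<le> - (a ^ p * (a - b))" .
  have pos: "0 \<le> a ^ p * (a - b)" using ab b by simp
  have S0: "(\<Sum>i\<in>J. y i ^ p * (b - y i)) = 0"
    using S2 pos sum_nonneg[of J "\<lambda>i. y i ^ p * (b - y i)"] nn by auto
  then have vals: "y i = 0 \<or> y i = b" if "i \<in> J" for i
    using sum_nonneg_eq_0_iff[OF fin, of "\<lambda>i. y i ^ p * (b - y i)"] nn that p by auto
  have "a ^ p * (a - b) = 0" using S2 pos S0 by linarith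
  then have "a = b" using ab b p by auto
  show ?thesis
  proof (cases "b = 0")
    case True
    then have "{i\<in>J. y i \<noteq> 0} = {}" using vals by auto
    then show ?thesis by (simp only: card.empty)
  next
    case False
    then show ?thesis
      using card_nonzero_le_if_vals[OF fin ev p False, of y 2] vals sum \<open>a = b\<close> by simp
  qed
next
  case False
  \<comment> \<open>Any entry above \<open>b\<close> can serve as \<open>c\<close>: from
    \<open>b \<le> c \<le> a\<close> it follows that \<open>z\<close> lies between \<open>b\<close>
    and \<open>a\<close> as well.\<close>
  then obtain j where j: "j \<in> J" "y j > b" by force
  define c where "c = y j"
  define z where "z = root p (a ^ p + b ^ p - c ^ p)"
  let ?J = "J - {j}"
  have ca: "b \<le> c" "c \<le> a" using j le[of j] by (auto simp: c_def)
  have pw: "b ^ p \<le> c ^ p" "c ^ p \<le> a ^ p" using ca b by (auto intro!: power_mono)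
  then have "0 \<le> a ^ p + b ^ p - c ^ p" using zero_le_power[OF b, of p] by linarith
  then have z: "0 \<le> z" "z ^ p = a ^ p + b ^ p - c ^ p" using p by (auto simp: z_def)
  have za: "z \<le> a" "b \<le> z"
    using pw z b ab p power_mono_iff[of z a p] power_mono_iff[of b z p] by auto
  have two: "c ^ Suc p + z ^ Suc p \<le> a ^ Suc p + b ^ Suc p"
    using power_sum_two_terms_mono[of p b c a z] p b ca za z by simp
  have sumJ: "(\<Sum>i\<in>?J. y i ^ p) \<le> z ^ p"
    using sum fin j by (simp add: sum.remove c_def z)
  have eqJ: "z ^ Suc p \<le> (\<Sum>i\<in>?J. y i ^ Suc p)"
    using eq two fin j by (simp add: sum.remove c_def)
  \<comment> \<open>An even power controls the absolute value, so the bound on the power sum bounds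
    each single entry.\<close>
  have yz: "y i \<le> z" if "i \<in> ?J" for i
  proof -
    have "\<bar>y i\<bar> ^ p = y i ^ p" using ev by (simp add: power_even_abs)
    also have "\<dots> \<le> (\<Sum>i\<in>?J. y i ^ p)"
      using fin that ev by (intro member_le_sum) (auto simp: zero_le_power_eq)
    finally have "\<bar>y i\<bar> ^ p \<le> z ^ p" using sumJ by linarith
    then show ?thesis using p z(1) by (simp add: power_mono_iff)
  qed
  \<comment> \<open>The same squeeze as before, now with \<open>z\<close>: nonnegative terms with a
    sum at most 0 force every remaining entry to be 0 or \<open>z\<close>, and the bound
    \<open>z ^ p\<close> on the power sum leaves room for one \<open>z\<close>.\<close>
  have nn: "0 \<le> y i ^ p * (z - y i)" if "i \<in> ?J" for i
    using yz[OF that] ev by (simp add: zero_le_power_eq)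
  have "(\<Sum>i\<in>?J. y i ^ p * (z - y i)) = z * (\<Sum>i\<in>?J. y i ^ p) - (\<Sum>i\<in>?J. y i ^ Suc p)"
    by (simp add: sum_distrib_left sum_subtractf[symmetric] algebra_simps)
  also have "\<dots> \<le> z * z ^ p - z ^ Suc p"
    using sumJ eqJ z(1) by (intro diff_mono mult_left_mono)
  finally have "(\<Sum>i\<in>?J. y i ^ p * (z - y i)) = 0"
    using sum_nonneg[of ?J "\<lambda>i. y i ^ p * (z - y i)"] nn by auto
  then have vals: "y i = 0 \<or> y i = z" if "i \<in> ?J" for i
    using sum_nonneg_eq_0_iff[of ?J "\<lambda>i. y i ^ p * (z - y i)"] fin nn that p by auto
  have "card {i\<in>?J. y i \<noteq> 0} \<le> 1"
  proof (cases "z = 0")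
    case True
    then have "{i\<in>?J. y i \<noteq> 0} = {}" using vals by auto
    then show ?thesis by (simp only: card.empty)
  next
    case False
    then show ?thesis
      using card_nonzero_le_if_vals[OF _ ev p False, of ?J y 1] vals sumJ fin by simp
  qed
  moreover have "{i\<in>J. y i \<noteq> 0} \<subseteq> insert j {i\<in>?J. y i \<noteq> 0}" by auto
  ultimately show ?thesis
    using card_mono[of "insert j {i\<in>?J. y i \<noteq> 0}" "{i\<in>J. y i \<noteq> 0}"] fin
      card_insert_le_m1[of 2 "{i\<in>?J. y i \<noteq> 0}" j] by fastforce
qed

text \<open>With \<open>s\<close> the sum of the entries, the nonnegative terms
  \<open>y i * (s\<^sup>2 - (y i)\<^sup>2)\<close> add up to 0, so every nonzero entry equals
  \<open>s\<close>. Two such entries would already exceed the sum.\<close>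

lemma card_nonzero_le_1_if_sum_cubes:
  fixes y :: "'i \<Rightarrow> real"
  assumes fin: "finite J" and nn: "\<And>i. i \<in> J \<Longrightarrow> 0 \<le> y i"
    and cubes: "(\<Sum>i\<in>J. y i ^ 3) = (\<Sum>i\<in>J. y i) ^ 3"
  shows "card {i\<in>J. y i \<noteq> 0} \<le> 1"
proof -
  define s where "s = (\<Sum>i\<in>J. y i)"
  have ys: "y i \<le> s" if "i \<in> J" for i
    unfolding s_def using fin that nn by (intro member_le_sum) auto
  have t: "0 \<le> y i * (s\<^sup>2 - (y i)\<^sup>2)" if "i \<in> J" for i
    using nn[OF that] power_mono[OF ys[OF that] nn[OF that], of 2] by simp
  have "(\<Sum>i\<in>J. y i * (s\<^sup>2 - (y i)\<^sup>2)) = s\<^sup>2 * s - (\<Sum>i\<in>J. y i ^ 3)"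
    by (simp add: s_def sum_distrib_left sum_subtractf[symmetric] algebra_simps power3_eq_cube power2_eq_square)
  also have "\<dots> = 0" using cubes by (simp add: s_def power3_eq_cube power2_eq_square)
  finally have "y i * (s\<^sup>2 - (y i)\<^sup>2) = 0" if "i \<in> J" for i
    using sum_nonneg_eq_0_iff[OF fin, of "\<lambda>i. y i * (s\<^sup>2 - (y i)\<^sup>2)"] t that by auto
  then have "s\<^sup>2 = (y i)\<^sup>2" if "i \<in> J" "y i \<noteq> 0" for i using that by force
  then have ys: "y i = s" if "i \<in> J" "y i \<noteq> 0" for i
    using that nn[OF that(1)] ys[OF that(1)] power2_eq_iff_nonneg[of s "y i"] by simp
  have "i = j" if "i \<in> J" "y i \<noteq> 0" "j \<in> J" "y j \<noteq> 0" for i j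
  proof (rule ccontr)
    assume "i \<noteq> j"
    then have "y i + y j = sum y {i, j}" by simp
    also have "\<dots> \<le> s" unfolding s_def using that fin nn by (intro sum_mono2) auto
    finally show False using ys[OF that(1,2)] ys[OF that(3,4)] that nn[OF that(1)] by simp
  qed
  then show ?thesis using fin by (auto simp: card_le_Suc0_iff_eq)
qed

text \<open>If \<open>- l j\<close> exceeded \<open>a\<close>, the negative term
  \<open>l j ^ Suc (2 * m)\<close> would outweigh all others for large \<open>m\<close>. For
  eigenvalues of a graph this takes the place of the Perron-Frobenius bound.\<close>

lemma neg_le_max_if_odd_power_sums_nonneg:
  fixes l :: "'i \<Rightarrow> real"
  assumes fin: "finite J" and le: "\<And>i. i \<in> J \<Longrightarrow> l i \<le> a"
    and nn: "\<And>m. 0 \<le> (\<Sum>i\<in>J. l i ^ Suc (2 * m))" and j: "j \<in> J"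
  shows "- l j \<le> a"
proof (rule ccontr)
  assume "\<not> - l j \<le> a"
  then have c: "a < - l j" by simp
  have bound: "(- l j) ^ Suc (2 * m) \<le> card J * a ^ Suc (2 * m)" for m
  \<comment> \<open>If the power of \<open>a\<close> is nonnegative, the missing term for
    \<open>j\<close> can be padded to reach \<open>card J\<close> terms; if it is negative, so is
    the whole power sum, which is excluded.\<close>
  proof (cases "0 \<le> a ^ Suc (2 * m)")
    case True
    have "0 \<le> l j ^ Suc (2 * m) + (\<Sum>i\<in>J - {j}. l i ^ Suc (2 * m))"
      using nn[of m] fin j by (simp add: sum.remove)
    also have "(\<Sum>i\<in>J - {j}. l i ^ Suc (2 * m)) \<le> (\<Sum>i\<in>J - {j}. a ^ Suc (2 * m))"
      using le by (intro sum_mono power_mono_odd) auto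
    also have "\<dots> \<le> (\<Sum>i\<in>J. a ^ Suc (2 * m))"
      using fin True by (intro sum_mono2) auto
    finally show ?thesis by simp
  next
    case False
    have "(\<Sum>i\<in>J. l i ^ Suc (2 * m)) \<le> (\<Sum>i\<in>J. a ^ Suc (2 * m))"
      using le by (intro sum_mono power_mono_odd) auto
    moreover have "0 < card J" using fin j card_gt_0_iff by blast
    then have "card J * a ^ Suc (2 * m) < 0" using False by (intro mult_pos_neg) auto
    ultimately show ?thesis using nn[of m] by simp
  qed
  show False
  proof (cases "0 < a")
    case True
    then have q: "1 < - l j / a" using c by (simp add: field_simps)
    then obtain m where m: "real (card J) < (- l j / a) ^ m" using real_arch_pow by blast
    also have "\<dots> \<le> (- l j / a) ^ Suc (2 * m)" using q by (intro power_increasing) auto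
    also have "\<dots> = (- l j) ^ Suc (2 * m) / a ^ Suc (2 * m)" by (rule power_divide)
    also have "\<dots> \<le> card J" using bound[of m] True
      by (subst pos_divide_le_eq) auto
    finally show False by simp
  next
    \<comment> \<open>For \<open>a \<le> 0\<close> the exponent 1 suffices, since
      \<open>card J * a \<le> a\<close>.\<close>
    case False
    have "- l j \<le> card J * a" using bound[of 0] by simp
    moreover have "0 < card J" using fin j card_gt_0_iff by blast
    then have "card J * a \<le> 1 * a" using False by (intro mult_right_mono_neg) auto
    ultimately show False using c by linarith
  qed
qed

text \<open>Padding with zeros yields exactly two numbers however many entries are nonzero. The
  exponent must be positive because \<open>0 ^ 0 = 1\<close>.\<close>

lemma card_2_power_sum:
  fixes l :: "'i \<Rightarrow> real"
  assumes "finite J" "card {i\<in>J. l i \<noteq> 0} \<le> 2"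
  obtains c d where "\<And>t. 0 < t \<Longrightarrow> (\<Sum>i\<in>J. l i ^ t) = c ^ t + d ^ t"
    "c = 0 \<or> c \<in> l ` J" "d = 0 \<or> d \<in> l ` J"
proof -
  let ?N = "{i\<in>J. l i \<noteq> 0}"
  have eq: "(\<Sum>i\<in>J. l i ^ t) = (\<Sum>i\<in>?N. l i ^ t)" if "0 < t" for t
    using assms that by (intro sum.mono_neutral_right) auto
  from assms(2) consider "card ?N = 0" | "card ?N = 1" | "card ?N = 2" by linarith
  then show thesis
  proof cases
    case 1
    then have "?N = {}" using assms(1) by simp
    then show thesis using that[of 0 0] eq by (simp only: sum.empty) auto
  next
    case 2
    then obtain i where i: "?N = {i}" by (auto simp: card_1_singleton_iff)
    then have "i \<in> J" by auto
    then show thesis using that[of "l i" 0] eq i by auto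
  next
    case 3
    then obtain i j where ij: "?N = {i, j}" "i \<noteq> j" by (auto simp: card_2_iff)
    then have "i \<in> J" "j \<in> J" by auto
    then show thesis using that[of "l i" "l j"] eq ij by auto
  qed
qed

section \<open>Decreasing sequences with vanishing sum and vanishing sum of cubes\<close>

context
  fixes l :: "nat \<Rightarrow> real" and n :: nat
  assumes n: "3 \<le> n" and dec: "\<And>i j. i \<le> j \<Longrightarrow> j < n \<Longrightarrow> l j \<le> l i"
    and sum1: "(\<Sum>i<n. l i) = 0" and sum3: "(\<Sum>i<n. l i ^ 3) = 0"
begin

lemma sum_split_first: "(\<Sum>i<n. f (l i)) = f (l 0) + (\<Sum>i\<in>{1..<n}. f (l i))" for f :: "real \<Rightarrow> real"
  using n by (simp add: atLeast0LessThan[symmetric] sum.atLeast_Suc_lessThan)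

lemma sum_split_first_two: "(\<Sum>i<n. f (l i)) = f (l 0) + f (l 1) + (\<Sum>i\<in>{2..<n}. f (l i))"
  for f :: "real \<Rightarrow> real"
  using n sum.atLeast_Suc_lessThan[of 1 n "\<lambda>i. f (l i)"] by (simp add: sum_split_first numeral_2_eq_2)

text \<open>The numbers \<open>- l i\<close> with \<open>i \<ge> 1\<close> are nonnegative, their
  sum is \<open>l 0\<close> and their cubes sum to \<open>l 0 ^ 3\<close>, so the lemma on cubes
  applies.\<close>

lemma card_nonzero_if_second_nonpos:
  assumes "l 1 \<le> 0"
  shows "card {i\<in>{1..<n}. l i \<noteq> 0} \<le> 1"
proof -
  have "(\<Sum>i\<in>{1..<n}. (- l i) ^ 3) = (\<Sum>i\<in>{1..<n}. - l i) ^ 3"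
    using sum1 sum3 sum_split_first[of "\<lambda>x. x"] sum_split_first[of "\<lambda>x. x ^ 3"]
    by (simp add: sum_negf add_eq_0_iff)
  then have "card {i\<in>{1..<n}. - l i \<noteq> 0} \<le> 1"
    using assms dec[of 1] by (intro card_nonzero_le_1_if_sum_cubes) force+
  then show ?thesis by simp
qed

text \<open>A negative \<open>l 1\<close> would make \<open>l 2\<close> negative too, giving two
  nonzero entries after the first; \<open>3 \<le> n\<close> supplies the index 2.\<close>

lemma second_nonneg: "0 \<le> l 1"
proof (rule ccontr)
  assume neg: "\<not> 0 \<le> l 1"
  then have "{1, 2} \<subseteq> {i\<in>{1..<n}. l i \<noteq> 0}" using dec[of 1 2] n by auto
  then have "card {1, 2 :: nat} \<le> card {i\<in>{1..<n}. l i \<noteq> 0}" by (intro card_mono) auto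
  then show False using card_nonzero_if_second_nonpos neg by simp
qed

text \<open>Beyond \<open>l 0\<close> and \<open>l 1\<close> the power sums are those of two numbers
  \<open>c\<close> and \<open>d\<close>. The conditions on the sum and on the cubes pair the four
  numbers into opposites.\<close>

lemma power_sum_if_card_nonzero_le_4:
  assumes card: "card {i\<in>{..<n}. l i \<noteq> 0} \<le> 4" and t: "0 < t"
  shows "(\<Sum>i<n. l i ^ t) = l 0 ^ t + l 1 ^ t + (- l 0) ^ t + (- l 1) ^ t"
proof -
  let ?a = "l 0" and ?b = "l 1"
  have b: "0 \<le> ?b" "?b \<le> ?a" using second_nonneg dec[of 0 1] n by auto
  have c2: "card {i\<in>{2..<n}. l i \<noteq> 0} \<le> 2"
  proof (cases "?b = 0")
    \<comment> \<open>Here \<open>l 1\<close> does not count among the nonzero entries, so the bound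
      comes from the case of a nonpositive second entry.\<close>
    case True
    have "card {i\<in>{2..<n}. l i \<noteq> 0} \<le> card {i\<in>{1..<n}. l i \<noteq> 0}" by (intro card_mono) auto
    then show ?thesis using card_nonzero_if_second_nonpos True by simp
  next
    case False
    have "{..<n} = {0, 1} \<union> {2..<n}" using n by auto
    then have "{i\<in>{..<n}. l i \<noteq> 0} = {i\<in>{0, 1}. l i \<noteq> 0} \<union> {i\<in>{2..<n}. l i \<noteq> 0}" by blast
    also have "{i\<in>{0, 1}. l i \<noteq> 0} = {0, 1}" using False b by auto
    finally have "card {i\<in>{..<n}. l i \<noteq> 0} = card ({0, 1} \<union> {i\<in>{2..<n}. l i \<noteq> 0})" by (rule arg_cong)
    moreover have "card ({0, 1} \<union> {i\<in>{2..<n}. l i \<noteq> 0}) = 2 + card {i\<in>{2..<n}. l i \<noteq> 0}"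
      by (subst card_Un_disjoint) auto
    ultimately show ?thesis using card by simp
  qed
  obtain c d where cd: "\<And>t. 0 < t \<Longrightarrow> (\<Sum>i\<in>{2..<n}. l i ^ t) = c ^ t + d ^ t"
    and "c = 0 \<or> c \<in> l ` {2..<n}" "d = 0 \<or> d \<in> l ` {2..<n}"
    by (rule card_2_power_sum[OF finite_atLeastLessThan c2]) blast
  then have le: "c \<le> ?b" "d \<le> ?b" using b dec[of 1] by auto
  have s: "?a + ?b + c + d = 0"
    using sum1 sum_split_first_two[of "\<lambda>x. x"] cd[of 1] by simp
  have "?a ^ 3 + ?b ^ 3 + c ^ 3 + d ^ 3 = 0"
    using sum3 sum_split_first_two[of "\<lambda>x. x ^ 3"] cd[of 3] by simp
  moreover have "d = - (?a + ?b + c)" using s by linarith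
  then have "d ^ 3 = - ((?a + ?b + c) ^ 3)" by (simp only: power3_eq_cube mult_minus_left mult_minus_right minus_minus)
  \<comment> \<open>After \<open>d\<close> is eliminated, the cube condition becomes a product of
    three pairwise sums.\<close>
  moreover have "(x + y + z) ^ 3 = x ^ 3 + y ^ 3 + z ^ 3 + 3 * ((x + y) * ((y + z) * (x + z)))"
    for x y z :: real
    by (simp add: power3_eq_cube algebra_simps)
  from this[of ?a ?b c] have "3 * ((?a + ?b) * ((?b + c) * (?a + c))) = 0"
    using calculation by linarith
  then have "(?a + ?b) * ((?b + c) * (?a + c)) = 0" by (simp only: mult_eq_0_iff) simp
  \<comment> \<open>The first case makes \<open>l 0\<close> and \<open>l 1\<close> zero; then
    \<open>c\<close> and \<open>d\<close> are nonpositive with sum 0, hence zero as well.\<close>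
  then consider "?a + ?b = 0" | "c = - ?b" | "c = - ?a" by force
  then have "c = - ?b \<and> d = - ?a \<or> c = - ?a \<and> d = - ?b"
    using s b le by cases auto
  then show ?thesis
    using sum_split_first_two[of "\<lambda>x. x ^ t"] cd[OF t] by auto
qed

lemma top_two_power_sum_le:
  assumes k: "0 < k" and odd: "(\<Sum>i<n. l i ^ Suc (2 * k)) = 0"
    and nn: "\<And>m. 0 \<le> (\<Sum>i<n. l i ^ Suc (2 * m))"
  shows "l 0 ^ (2 * k) + l 1 ^ (2 * k) \<le> (\<Sum>i<n. l i ^ (2 * k)) / 2"
    and "l 0 ^ (2 * k) + l 1 ^ (2 * k) = (\<Sum>i<n. l i ^ (2 * k)) / 2
      \<longleftrightarrow> card {i\<in>{..<n}. l i \<noteq> 0} \<le> 4"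
proof -
  let ?p = "2 * k"
  have b: "0 \<le> l 1" "l 1 \<le> l 0" using second_nonneg dec[of 0 1] n by auto
  have eq: "l 0 ^ ?p + l 1 ^ ?p = (\<Sum>i<n. l i ^ ?p) / 2" if "card {i\<in>{..<n}. l i \<noteq> 0} \<le> 4"
    using power_sum_if_card_nonzero_le_4[OF that, of ?p] k by simp
  have le4: "card {i\<in>{..<n}. l i \<noteq> 0} \<le> 4" if ge: "(\<Sum>i<n. l i ^ ?p) / 2 \<le> l 0 ^ ?p + l 1 ^ ?p"
  proof -
    let ?J = "{2..<n}"
    have "(\<Sum>i\<in>?J. (- l i) ^ ?p) \<le> l 0 ^ ?p + l 1 ^ ?p"
      using ge sum_split_first_two[of "\<lambda>x. x ^ ?p"] by simp
    moreover have "(\<Sum>i\<in>?J. (- l i) ^ Suc ?p) = l 0 ^ Suc ?p + l 1 ^ Suc ?p"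
      using odd sum_split_first_two[of "\<lambda>x. x ^ Suc ?p"] by (simp add: sum_negf)
    moreover have "- l i \<le> l 0" if "i \<in> ?J" for i
      using neg_le_max_if_odd_power_sums_nonneg[of "{..<n}" l "l 0" i] dec nn that by auto
    ultimately have "card {i\<in>?J. - l i \<noteq> 0} \<le> 2"
      using k b by (intro card_nonzero_le_2_if_power_sums[of _ ?p "l 1" "l 0"]) auto
    then have "card ({0, 1} \<union> {i\<in>?J. l i \<noteq> 0}) \<le> 4"
      using card_Un_le[of "{0, 1}" "{i\<in>?J. l i \<noteq> 0}"] by simp
    moreover have "{i\<in>{..<n}. l i \<noteq> 0} \<subseteq> {0, 1} \<union> {i\<in>?J. l i \<noteq> 0}" by auto
    then have "card {i\<in>{..<n}. l i \<noteq> 0} \<le> card ({0, 1} \<union> {i\<in>?J. l i \<noteq> 0})"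
      by (intro card_mono) auto
    ultimately show ?thesis by simp
  qed
  show "l 0 ^ ?p + l 1 ^ ?p \<le> (\<Sum>i<n. l i ^ ?p) / 2"
    \<comment> \<open>Either the inequality holds outright, or the reverse one does; the latter
      leaves at most four nonzero entries and therefore gives equality.\<close>
    by (rule linorder_le_cases, assumption) (rule eq_refl[OF eq[OF le4]])
  show "l 0 ^ ?p + l 1 ^ ?p = (\<Sum>i<n. l i ^ ?p) / 2 \<longleftrightarrow> card {i\<in>{..<n}. l i \<noteq> 0} \<le> 4"
    by (rule iffI, rule le4, erule eq_refl[OF sym], erule eq)
qed

end

section \<open>Real symmetric matrices\<close>

text \<open>Gaussian elimination by induction on the set \<open>L\<close> of equations, with the
  unknowns indexed by \<open>S\<close>.\<close>

lemma exists_nontrivial_solution: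
  fixes F :: "'l \<Rightarrow> 'i \<Rightarrow> 'f :: field"
  assumes "finite L" "finite S" "card L < card S"
  shows "\<exists>c. (\<exists>s\<in>S. c s \<noteq> 0) \<and> (\<forall>l\<in>L. (\<Sum>s\<in>S. c s * F l s) = 0)"
  using assms
proof (induction L arbitrary: S F rule: finite_induct)
  case empty
  then obtain s where "s \<in> S" by fastforce
  then show ?case by (intro exI[of _ "\<lambda>_. 1"]) auto
next
  case (insert m L)
  show ?case
  proof (cases "\<forall>s\<in>S. F m s = 0")
    case True
    from insert.IH[of S F] insert.prems insert.hyps
    obtain c where "\<exists>s\<in>S. c s \<noteq> 0" "\<forall>l\<in>L. (\<Sum>s\<in>S. c s * F l s) = 0"
      by auto
    with True show ?thesis by (intro exI[of _ c]) auto
  next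
    case False
    then obtain r where r: "r \<in> S" "F m r \<noteq> 0" by auto
    let ?S = "S - {r}"
    have "finite ?S" "card L < card ?S" using insert.prems insert.hyps r by auto
    \<comment> \<open>Equation \<open>m\<close> with pivot \<open>r\<close> eliminates the unknown
      \<open>r\<close> from all other equations; \<open>d\<close> below restores it by solving
      equation \<open>m\<close>.\<close>
    from insert.IH[OF this, of "\<lambda>l s. F l s - F l r * F m s / F m r"]
    obtain c where c: "\<exists>s\<in>?S. c s \<noteq> 0"
      "\<forall>l\<in>L. (\<Sum>s\<in>?S. c s * (F l s - F l r * F m s / F m r)) = 0"
      by auto
    define d where "d = c(r := - (\<Sum>s\<in>?S. c s * F m s) / F m r)"
    have sum: "(\<Sum>s\<in>S. d s * F l s) = (\<Sum>s\<in>?S. c s * (F l s - F l r * F m s / F m r))" for l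
    proof -
      have "(\<Sum>s\<in>S. d s * F l s) = d r * F l r + (\<Sum>s\<in>?S. c s * F l s)"
        using insert.prems(1) r(1) by (simp add: sum.remove d_def)
      also have "\<dots> = (\<Sum>s\<in>?S. c s * (F l s - F l r * F m s / F m r))"
        by (simp add: d_def algebra_simps sum_subtractf sum_distrib_left sum_divide_distrib sum_negf)
      finally show ?thesis .
    qed
    have "(\<Sum>s\<in>S. d s * F m s) = 0" unfolding sum using r(2) by simp
    moreover have "\<exists>s\<in>S. d s \<noteq> 0" using c(1) by (auto simp: d_def)
    moreover have "\<forall>l\<in>L. (\<Sum>s\<in>S. d s * F l s) = 0" unfolding sum by (rule c(2))
    ultimately show ?thesis by (intro exI[of _ d]) auto
  qed
qed

section \<open>Traces of powers and triangular forms\<close>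

lemma trace_mat_comm:
  fixes X Y :: "'f :: comm_ring_1 mat"
  assumes "X \<in> carrier_mat n n" "Y \<in> carrier_mat n n"
  shows "trace_mat (X * Y) = trace_mat (Y * X)"
proof -
  have *: "trace_mat (X * Y) = (\<Sum>i<n. \<Sum>j<n. X $$ (i, j) * Y $$ (j, i))"
    if "X \<in> carrier_mat n n" "Y \<in> carrier_mat n n" for X Y :: "'f mat"
    using that by (auto simp: trace_mat_def scalar_prod_def atLeast0LessThan intro!: sum.cong)
  show ?thesis unfolding *[OF assms] *[OF assms(2,1)]
    by (subst sum.swap) (simp add: mult.commute)
qed

lemma upper_triangular_pow:
  fixes B :: "'f :: comm_ring_1 mat"
  assumes B: "B \<in> carrier_mat n n" and ut: "upper_triangular B"
  shows "i < n \<Longrightarrow> j < n \<Longrightarrow> j \<le> i \<Longrightarrow>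
    (B ^\<^sub>m t) $$ (i, j) = (if i = j then B $$ (i, i) ^ t else 0)"
proof (induction t arbitrary: i j)
  case (Suc t)
  have "(B ^\<^sub>m Suc t) $$ (i, j) = (\<Sum>k<n. (B ^\<^sub>m t) $$ (i, k) * B $$ (k, j))"
    using Suc.prems B by (simp add: scalar_prod_def atLeast0LessThan)
  \<comment> \<open>For \<open>k < i\<close> the power has a zero below its diagonal; for
    \<open>k > i\<close> the factor \<open>B\<close> has one, since
    \<open>j \<le> i < k\<close>.\<close>
  also have "\<dots> = (\<Sum>k<n. if k = i then (B ^\<^sub>m t) $$ (i, i) * B $$ (i, j) else 0)"
  proof (intro sum.cong refl)
    fix k assume "k \<in> {..<n}"
    then show "(B ^\<^sub>m t) $$ (i, k) * B $$ (k, j) = (if k = i then (B ^\<^sub>m t) $$ (i, i) * B $$ (i, j) else 0)"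
      using Suc.IH[of i k] Suc.prems upper_triangularD[OF ut, of j k] B
      by (cases "k < i"; cases "k = i") auto
  qed
  also have "\<dots> = (if i = j then B $$ (i, i) ^ Suc t else 0)"
    using Suc.IH[of i i] Suc.prems upper_triangularD[OF ut, of j i] B by auto
  finally show ?case .
qed (use B in auto)

lemma trace_pow_similar_triangular:
  fixes A :: "'f :: field mat"
  assumes A: "A \<in> carrier_mat n n" and sim: "similar_mat_wit A B P Q" and ut: "upper_triangular B"
  shows "trace_mat (A ^\<^sub>m t) = (\<Sum>i<n. B $$ (i, i) ^ t)"
proof -
  note D = similar_mat_witD2[OF A sim]
  have "trace_mat (A ^\<^sub>m t) = trace_mat (P * (B ^\<^sub>m t * Q))"
    using similar_mat_wit_pow_id[OF sim, of t] D by (simp add: assoc_mult_mat[of _ n n _ n _ n])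
  also have "\<dots> = trace_mat (B ^\<^sub>m t * Q * P)" using D by (intro trace_mat_comm) auto
  also have "\<dots> = trace_mat (B ^\<^sub>m t)" using D by (simp add: assoc_mult_mat[of _ n n _ n _ n])
  also have "\<dots> = (\<Sum>i<n. B $$ (i, i) ^ t)"
    using D upper_triangular_pow[OF D(5) ut, of _ _ t] by (simp add: trace_mat_def)
  finally show ?thesis .
qed

text \<open>For an eigenvector \<open>w\<close>, the Hermitian form of \<open>A\<close> at
  \<open>w\<close> equals \<open>\<mu>\<close> times the squared norm of \<open>w\<close>, and
  symmetry makes the form its own conjugate.\<close>

lemma eigenvalue_of_real_symmetric:
  fixes A :: "real mat"
  assumes A: "A \<in> carrier_mat n n" and sym: "A\<^sup>T = A"
    and ev: "eigenvalue (map_mat complex_of_real A) \<mu>"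
  shows "\<mu> \<in> \<real>"
proof -
  let ?C = "map_mat complex_of_real A"
  have C: "?C \<in> carrier_mat n n" using A by simp
  from ev obtain v where v: "v \<in> carrier_vec n" "v \<noteq> 0\<^sub>v n" "?C *\<^sub>v v = \<mu> \<cdot>\<^sub>v v"
    using A by (auto simp: eigenvalue_def eigenvector_def)
  define w where "w i = v $ i" for i
  have Aw: "(\<Sum>j<n. A $$ (i, j) * w j) = \<mu> * w i" if "i < n" for i
    using arg_cong[OF v(3), of "\<lambda>x. x $ i"] that A v(1)
    by (simp add: scalar_prod_def atLeast0LessThan w_def)
  have symA: "A $$ (i, j) = A $$ (j, i)" if "i < n" "j < n" for i j
    using arg_cong[OF sym, of "\<lambda>x. x $$ (i, j)"] that A by simp
  let ?q = "\<Sum>i<n. \<Sum>j<n. cnj (w i) * (A $$ (i, j) * w j)"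
  have q: "?q = \<mu> * (\<Sum>i<n. cnj (w i) * w i)"
    by (simp add: sum_distrib_left[symmetric] Aw) (simp add: sum_distrib_left algebra_simps)
  have nrm: "(\<Sum>i<n. cnj (w i) * w i) = of_real (\<Sum>i<n. (cmod (w i))\<^sup>2)"
    by (simp only: of_real_sum complex_norm_square mult.commute)
  have "cnj ?q = (\<Sum>i<n. \<Sum>j<n. w i * (A $$ (i, j) * cnj (w j)))" by simp
  also have "\<dots> = (\<Sum>j<n. \<Sum>i<n. w i * (A $$ (i, j) * cnj (w j)))" by (rule sum.swap)
  also have "\<dots> = ?q" by (intro sum.cong refl) (auto simp: symA)
  finally have "cnj ?q = ?q" .
  then have "(cnj \<mu> - \<mu>) * of_real (\<Sum>i<n. (cmod (w i))\<^sup>2) = 0"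
    unfolding q nrm by (simp add: algebra_simps)
  moreover have "(\<Sum>i<n. (cmod (w i))\<^sup>2) \<noteq> 0"
  proof
    assume "(\<Sum>i<n. (cmod (w i))\<^sup>2) = 0"
    then have "\<forall>i<n. w i = 0" by (subst (asm) sum_nonneg_eq_0_iff) auto
    then show False using v by (auto simp: w_def)
  qed
  ultimately have "cnj \<mu> = \<mu>" by (metis mult_eq_0_iff of_real_eq_0_iff eq_iff_diff_eq_0)
  then show ?thesis by (simp add: Reals_cnj_iff)
qed

text \<open>The complex roots are real, so the complex factorisation is the image of a real one.
  This permits a Schur decomposition over the reals.\<close>

lemma char_poly_splits_if_real_symmetric:
  fixes A :: "real mat"
  assumes A: "A \<in> carrier_mat n n" and sym: "A\<^sup>T = A"
  obtains es where "char_poly A = (\<Prod>e\<leftarrow>es. [:- e, 1:])" "length es = n"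
proof -
  let ?C = "map_mat complex_of_real A"
  have C: "?C \<in> carrier_mat n n" using A by simp
  from char_poly_factorized[OF C] obtain as
    where as: "char_poly ?C = (\<Prod>a\<leftarrow>as. [:- a, 1:])" "length as = n" by auto
  have real: "a \<in> \<real>" if "a \<in> set as" for a
  proof (rule eigenvalue_of_real_symmetric[OF A sym])
    have "poly (char_poly ?C) a = 0"
      unfolding as using that by (auto simp: poly_prod_list prod_list_zero_iff)
    then show "eigenvalue ?C a" using eigenvalue_root_char_poly[OF C] by simp
  qed
  define es where "es = map Re as"
  have as_es: "as = map complex_of_real es"
    using real by (auto simp: es_def map_idI of_real_Re)
  interpret h: map_poly_inj_idom_hom complex_of_real ..
  have "map_poly complex_of_real (char_poly A) = map_poly complex_of_real (\<Prod>e\<leftarrow>es. [:- e, 1:])"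
    using of_real_hom.char_poly_hom[OF A, where 'a = complex] as unfolding as_es
    by (simp add: h.hom_prod_list o_def)
  then have "char_poly A = (\<Prod>e\<leftarrow>es. [:- e, 1:])" by (simp only: h.eq_iff)
  then show thesis by (rule that) (simp add: es_def as(2))
qed

lemma pow_mat_Suc_left:
  assumes "A \<in> carrier_mat n n"
  shows "A ^\<^sub>m Suc k = A * A ^\<^sub>m k"
proof (induction k)
  case (Suc k)
  have "A ^\<^sub>m Suc (Suc k) = (A * A ^\<^sub>m k) * A" using Suc by simp
  also have "\<dots> = A * A ^\<^sub>m Suc k"
    using assoc_mult_mat[OF assms pow_carrier_mat[OF assms] assms, of k] by simp
  finally show ?case .
qed (use assms in simp)

text \<open>The factorisation bounds the rank by \<open>card L\<close> and is carried over to the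
  triangular matrix \<open>B\<close>, whose rows with nonzero diagonal entry are
  independent.\<close>

lemma card_nonzero_diag_le_if_factorization:
  fixes A :: "'f :: field mat"
  assumes A: "A \<in> carrier_mat n n" and sim: "similar_mat_wit A B P Q" and ut: "upper_triangular B"
    and L: "finite L"
    and fac: "\<And>i j. i < n \<Longrightarrow> j < n \<Longrightarrow> A $$ (i, j) = (\<Sum>l\<in>L. f l i * g l j)"
  shows "card {i\<in>{..<n}. B $$ (i, i) \<noteq> 0} \<le> card L"
proof (rule ccontr)
  let ?N = "{i\<in>{..<n}. B $$ (i, i) \<noteq> 0}"
  assume "\<not> card ?N \<le> card L"
  then have card: "card L < card ?N" by simp
  note D = similar_mat_witD2[OF A sim]
  define F where "F l s = (\<Sum>i<n. Q $$ (s, i) * f l i)" for l s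
  define G where "G l t = (\<Sum>j<n. g l j * P $$ (j, t))" for l t
  have "B = Q * A * P" using similar_mat_witD2(3)[OF D(5) similar_mat_wit_sym[OF sim]] .
  then have B: "B $$ (s, t) = (\<Sum>l\<in>L. F l s * G l t)" if "s < n" "t < n" for s t
  proof -
    have "B $$ (s, t) = (\<Sum>i<n. Q $$ (s, i) * (\<Sum>j<n. A $$ (i, j) * P $$ (j, t)))"
      using \<open>B = Q * A * P\<close> A D(6,7) that by (simp add: scalar_prod_def atLeast0LessThan)
    also have "\<dots> = (\<Sum>i<n. \<Sum>j<n. \<Sum>l\<in>L. (Q $$ (s, i) * f l i) * (g l j * P $$ (j, t)))"
      by (simp add: fac sum_distrib_left sum_distrib_right mult.assoc)
    also have "\<dots> = (\<Sum>i<n. \<Sum>l\<in>L. \<Sum>j<n. (Q $$ (s, i) * f l i) * (g l j * P $$ (j, t)))"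
      by (intro sum.cong refl sum.swap)
    also have "\<dots> = (\<Sum>l\<in>L. \<Sum>i<n. \<Sum>j<n. (Q $$ (s, i) * f l i) * (g l j * P $$ (j, t)))"
      by (rule sum.swap)
    also have "\<dots> = (\<Sum>l\<in>L. F l s * G l t)"
      unfolding F_def G_def by (simp add: sum_product)
    finally show ?thesis .
  qed
  from exists_nontrivial_solution[OF L _ card, of F]
  obtain c where c: "\<exists>s\<in>?N. c s \<noteq> 0" "\<forall>l\<in>L. (\<Sum>s\<in>?N. c s * F l s) = 0"
    by auto
  \<comment> \<open>At the least index \<open>s\<close> in the support of the relation, column
    \<open>s\<close> of the combined rows reduces to \<open>c s * B $$ (s, s)\<close>, which is
    nonzero.\<close>
  define s where "s = (LEAST s. s \<in> ?N \<and> c s \<noteq> 0)"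
  have s: "s \<in> ?N \<and> c s \<noteq> 0" unfolding s_def by (rule LeastI_ex) (use c(1) in auto)
  have less: "c r = 0" if "r \<in> ?N" "r < s" for r
    using not_less_Least[of r "\<lambda>s. s \<in> ?N \<and> c s \<noteq> 0"] that by (auto simp: s_def)
  have "(\<Sum>r\<in>?N. c r * B $$ (r, s)) = (\<Sum>r\<in>?N. \<Sum>l\<in>L. (c r * F l r) * G l s)"
    using s by (intro sum.cong refl) (simp add: B sum_distrib_left mult.assoc)
  also have "\<dots> = (\<Sum>l\<in>L. (\<Sum>r\<in>?N. c r * F l r) * G l s)"
    by (subst sum.swap) (simp add: sum_distrib_right)
  also have "\<dots> = 0" using c(2) by simp
  also have "(\<Sum>r\<in>?N. c r * B $$ (r, s)) = (\<Sum>r\<in>?N. if r = s then c s * B $$ (s, s) else 0)"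
  proof (intro sum.cong refl)
    fix r assume "r \<in> ?N"
    then show "c r * B $$ (r, s) = (if r = s then c s * B $$ (s, s) else 0)"
      using less[of r] upper_triangularD[OF ut, of s r] D(5) by (cases r s rule: linorder_cases) auto
  qed
  also have "\<dots> = c s * B $$ (s, s)" using s by simp
  finally show False using s by simp
qed

lemma symmetric_mult_vec_eq_0_if_pow:
  fixes A :: "real mat"
  assumes A: "A \<in> carrier_mat n n" and sym: "A\<^sup>T = A"
  shows "v \<in> carrier_vec n \<Longrightarrow> A ^\<^sub>m Suc m *\<^sub>v v = 0\<^sub>v n \<Longrightarrow> A *\<^sub>v v = 0\<^sub>v n"
proof (induction m arbitrary: v)
  case 0
  then show ?case using A by simp
next
  case (Suc m)
  let ?u = "A *\<^sub>v v"
  have u: "?u \<in> carrier_vec n" using A Suc.prems by simp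
  have "A ^\<^sub>m Suc (Suc m) *\<^sub>v v = A ^\<^sub>m Suc m *\<^sub>v ?u"
    using assoc_mult_mat_vec[OF pow_carrier_mat[OF A, of "Suc m"] A Suc.prems(1)] by simp
  with Suc have "A *\<^sub>v ?u = 0\<^sub>v n" using u by simp
  then have "v \<bullet> (A *\<^sub>v ?u) = 0" using Suc.prems by simp
  then have "?u \<bullet> ?u = 0"
    using transpose_vec_mult_scalar[of A n n v ?u] A u Suc.prems sym
    by (simp add: comm_scalar_prod[of _ n])
  then have "(\<Sum>i<n. ?u $ i * ?u $ i) = 0"
    unfolding scalar_prod_def carrier_vecD[OF u] atLeast0LessThan .
  then have "\<forall>i<n. ?u $ i = 0" by (subst (asm) sum_nonneg_eq_0_iff) auto
  then show ?case by (intro eq_vecI) (simp_all only: carrier_vecD[OF u] index_zero_vec)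
qed

text \<open>A generalised null vector of \<open>B\<close> is cut out by one linear condition for each nonzero diagonal
  entry, found by back substitution; symmetry makes generalised null vectors of \<open>A\<close> null vectors.\<close>
lemma symmetric_rows_dependent:
  fixes A :: "real mat"
  assumes A: "A \<in> carrier_mat n n" and sym: "A\<^sup>T = A"
    and sim: "similar_mat_wit A B P Q" and ut: "upper_triangular B"
    and S: "S \<subseteq> {..<n}" and card: "card {i\<in>{..<n}. B $$ (i, i) \<noteq> 0} < card S"
  obtains c where "\<exists>s\<in>S. c s \<noteq> 0" "\<And>j. j < n \<Longrightarrow> (\<Sum>s\<in>S. c s * A $$ (s, j)) = 0"
proof -
  let ?N = "{i\<in>{..<n}. B $$ (i, i) \<noteq> 0}"
  note D = similar_mat_witD2[OF A sim]
  have fS: "finite S" using S finite_subset by blast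
  \<comment> \<open>Row \<open>i\<close> becomes the next coordinate to be cleared after
    \<open>n - Suc i\<close> multiplications by \<open>B\<close>, which explains the
    exponent.\<close>
  from exists_nontrivial_solution[OF _ fS card, of "\<lambda>i s. (B ^\<^sub>m (n - Suc i) * Q) $$ (i, s)"]
  obtain c where c: "\<exists>s\<in>S. c s \<noteq> 0"
    "\<And>i. i \<in> ?N \<Longrightarrow> (\<Sum>s\<in>S. c s * (B ^\<^sub>m (n - Suc i) * Q) $$ (i, s)) = 0"
    by auto
  define v where "v = vec n (\<lambda>i. if i \<in> S then c i else 0)"
  have v: "v \<in> carrier_vec n" by (simp add: v_def)
  define w where "w = Q *\<^sub>v v"
  have w: "w \<in> carrier_vec n" using D v by (simp add: w_def)
  have mult_v: "(M *\<^sub>v v) $ i = (\<Sum>s\<in>S. c s * M $$ (i, s))" if "M \<in> carrier_mat n n" "i < n" for M i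
  proof -
    have "(M *\<^sub>v v) $ i = (\<Sum>s<n. M $$ (i, s) * (if s \<in> S then c s else 0))"
      using that by (simp add: scalar_prod_def v_def atLeast0LessThan)
    also have "\<dots> = (\<Sum>s\<in>S. c s * M $$ (i, s))"
      using S fS by (intro sum.mono_neutral_cong_right) (auto simp: mult.commute)
    finally show ?thesis .
  qed
  have cond: "(B ^\<^sub>m (n - Suc i) *\<^sub>v w) $ i = 0" if "i \<in> ?N" for i
  proof -
    have "B ^\<^sub>m (n - Suc i) *\<^sub>v w = (B ^\<^sub>m (n - Suc i) * Q) *\<^sub>v v"
      using D v by (simp add: w_def assoc_mult_mat_vec[of _ n n _ n])
    then show ?thesis
      using c(2)[OF that] mult_v[OF mult_carrier_mat[OF pow_carrier_mat[OF D(5)] D(7)], of i] that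
      by simp
  qed
  \<comment> \<open>Each multiplication by \<open>B\<close> clears one more coordinate from the
    bottom. The only new term is the diagonal one at \<open>n - Suc d\<close>, where either the
    diagonal entry is zero or \<open>cond\<close> applies.\<close>
  have zero: "d \<le> n \<Longrightarrow> n - d \<le> j \<Longrightarrow> j < n \<Longrightarrow> (B ^\<^sub>m d *\<^sub>v w) $ j = 0" for d j
  proof (induction d arbitrary: j)
    case (Suc d)
    let ?u = "B ^\<^sub>m d *\<^sub>v w"
    have u: "?u \<in> carrier_vec n" by (rule mult_mat_vec_carrier[OF pow_carrier_mat[OF D(5)] w])
    have "B ^\<^sub>m Suc d = B * B ^\<^sub>m d"
      by (rule pow_mat_Suc_left[OF D(5)])
    then have "(B ^\<^sub>m Suc d *\<^sub>v w) $ j = (B *\<^sub>v ?u) $ j"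
      using D w by (simp add: assoc_mult_mat_vec[of _ n n _ n])
    also have "\<dots> = (\<Sum>r<n. B $$ (j, r) * ?u $ r)"
      using D u Suc.prems by (simp add: scalar_prod_def atLeast0LessThan)
    also have "\<dots> = 0"
    proof (intro sum.neutral ballI)
      fix r assume r: "r \<in> {..<n}"
      consider "r < j" | "n - d \<le> r" | "r = n - Suc d" "r = j" using Suc.prems r by fastforce
      then show "B $$ (j, r) * ?u $ r = 0"
      proof cases
        case 1
        then show ?thesis using upper_triangularD[OF ut, of r j] D Suc.prems by simp
      next
        case 2
        then show ?thesis using Suc.IH[of r] Suc.prems r by simp
      next
        case 3
        then have "d = n - Suc r" using Suc.prems by simp
        then show ?thesis using cond[of r] 3 r by (cases "B $$ (r, r) = 0") auto
      qed
    qed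
    finally show ?case .
  qed (use D in auto)
  have "B ^\<^sub>m n *\<^sub>v w = 0\<^sub>v n" using zero[of n] D w by (intro eq_vecI) auto
  moreover have "A ^\<^sub>m n *\<^sub>v v = P *\<^sub>v (B ^\<^sub>m n *\<^sub>v w)"
    using similar_mat_wit_pow_id[OF sim, of n] D v
    by (simp add: w_def assoc_mult_mat_vec[of _ n n _ n])
  moreover have "P *\<^sub>v 0\<^sub>v n = 0\<^sub>v n" using D by (intro eq_vecI) auto
  ultimately have An: "A ^\<^sub>m n *\<^sub>v v = 0\<^sub>v n" by simp
  from c(1) S have "0 < n" by auto
  then have "A ^\<^sub>m Suc (n - 1) *\<^sub>v v = 0\<^sub>v n" using An by simp
  then have Av: "A *\<^sub>v v = 0\<^sub>v n" by (rule symmetric_mult_vec_eq_0_if_pow[OF A sym v])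
  show thesis
  proof (rule that[OF c(1)])
    fix j assume j: "j < n"
    have "(\<Sum>s\<in>S. c s * A $$ (s, j)) = (\<Sum>s\<in>S. c s * A $$ (j, s))"
    proof (intro sum.cong refl)
      fix s assume "s \<in> S"
      then have "s < n" using S by auto
      then have "A $$ (s, j) = A $$ (j, s)"
        using arg_cong[OF sym, of "\<lambda>x. x $$ (s, j)"] j A by simp
      then show "c s * A $$ (s, j) = c s * A $$ (j, s)" by simp
    qed
    also have "\<dots> = 0" using mult_v[OF A j] Av j by simp
    finally show "(\<Sum>s\<in>S. c s * A $$ (s, j)) = 0" .
  qed
qed

section \<open>Closed walks\<close>

text \<open>Walks over a bare relation, without the condition that the start is a vertex, so that
  they compare directly with \<open>R ^^ t\<close>.\<close>

definition walk_arcs :: "'a rel \<Rightarrow> nat \<Rightarrow> 'a \<Rightarrow> 'a \<Rightarrow> ('a \<times> 'a) list set" where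
  "walk_arcs R t u v = {p. set p \<subseteq> R \<and> pcas u p v \<and> length p = t}"

lemma walk_arcs_0: "walk_arcs R 0 u v = (if u = v then {[]} else {})"
  by (auto simp: walk_arcs_def)

lemma walk_arcs_Suc:
  "walk_arcs R (Suc t) u v = (\<Union>w\<in>{w. (u, w) \<in> R}. (#) (u, w) ` walk_arcs R t w v)"
proof (intro subset_antisym subsetI)
  fix p assume p: "p \<in> walk_arcs R (Suc t) u v"
  then obtain e q where "p = e # q" by (cases p) (auto simp: walk_arcs_def)
  with p show "p \<in> (\<Union>w\<in>{w. (u, w) \<in> R}. (#) (u, w) ` walk_arcs R t w v)"
    by (cases e) (auto simp: walk_arcs_def)
qed (auto simp: walk_arcs_def)

lemma finite_walk_arcs: "finite R \<Longrightarrow> finite (walk_arcs R t u v)"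
  by (rule finite_subset[OF _ finite_lists_length_eq[of R t]]) (auto simp: walk_arcs_def)

lemma walk_arcs_nonempty_iff: "walk_arcs R t u v \<noteq> {} \<longleftrightarrow> (u, v) \<in> R ^^ t"
proof (induction t arbitrary: u)
  case (Suc t)
  have "walk_arcs R (Suc t) u v \<noteq> {} \<longleftrightarrow> (\<exists>w. (u, w) \<in> R \<and> walk_arcs R t w v \<noteq> {})"
    by (auto simp: walk_arcs_Suc)
  also have "\<dots> \<longleftrightarrow> (u, v) \<in> R ^^ Suc t"
    unfolding Suc using relpow_Suc_I2[of u _ R v t] relpow_Suc_D2[of u v t R] by blast
  finally show ?case .
qed (auto simp: walk_arcs_0)

lemma card_walk_arcs_Suc:
  assumes "finite V" "R \<subseteq> V \<times> V"
  shows "card (walk_arcs R (Suc t) u v) = (\<Sum>w\<in>V. if (u, w) \<in> R then card (walk_arcs R t w v) else 0)"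
proof -
  have R: "finite R" using assms finite_subset by blast
  have "finite {w. (u, w) \<in> R}" using assms by (auto intro: finite_subset[of _ V])
  then have "card (walk_arcs R (Suc t) u v)
    = (\<Sum>w\<in>{w. (u, w) \<in> R}. card ((#) (u, w) ` walk_arcs R t w v))"
    unfolding walk_arcs_Suc using finite_walk_arcs[OF R]
    by (intro card_UN_disjoint) auto
  also have "\<dots> = (\<Sum>w\<in>{w. (u, w) \<in> R}. card (walk_arcs R t w v))"
    by (intro sum.cong refl card_image) (auto simp: inj_on_def)
  also have "\<dots> = (\<Sum>w\<in>V. if (u, w) \<in> R then card (walk_arcs R t w v) else 0)"
    using assms by (intro sum.mono_neutral_cong_left) auto
  finally show ?thesis .
qed

section \<open>Powers of the adjacency matrix and closed walks\<close>

lemma adjacency_matrix_carrier: "adjacency_matrix G vs \<in> carrier_mat (length vs) (length vs)"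
  by (simp add: adjacency_matrix_def)

lemma adjacency_matrix_index:
  "i < length vs \<Longrightarrow> j < length vs \<Longrightarrow>
    adjacency_matrix G vs $$ (i, j) = (if (vs ! i, vs ! j) \<in> parcs G then 1 else 0)"
  by (simp add: adjacency_matrix_def)

lemma sum_over_enumeration:
  assumes "distinct vs"
  shows "(\<Sum>v\<in>set vs. f v) = (\<Sum>i<length vs. f (vs ! i))"
  by (rule sum.reindex_bij_betw[symmetric]) (simp add: assms bij_betw_nth)

context
  fixes G :: "'a pair_pre_digraph" and vs :: "'a list"
  assumes G: "pair_graph G" and vs: "distinct vs" "set vs = pverts G"
begin

interpretation G: pair_graph G by (rule G)

lemma parcs_subset: "parcs G \<subseteq> pverts G \<times> pverts G"
  using G.in_arcsD1 G.in_arcsD2 by auto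

lemma adjacency_matrix_pow_index:
  assumes "i < length vs" "j < length vs"
  shows "(adjacency_matrix G vs ^\<^sub>m t) $$ (i, j) = card (walk_arcs (parcs G) t (vs ! i) (vs ! j))"
  using assms(1)
proof (induction t arbitrary: i)
  case 0
  then show ?case
    using assms vs by (simp add: walk_arcs_0 adjacency_matrix_def nth_eq_iff_index_eq)
next
  case (Suc t)
  let ?A = "adjacency_matrix G vs" and ?n = "length vs"
  note A = adjacency_matrix_carrier[of G vs]
  have "(?A ^\<^sub>m Suc t) $$ (i, j) = (\<Sum>k<?n. ?A $$ (i, k) * (?A ^\<^sub>m t) $$ (k, j))"
    unfolding pow_mat_Suc_left[OF A]
    using A pow_carrier_mat[OF A, of t] Suc.prems assms(2)
    by (simp add: scalar_prod_def atLeast0LessThan)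
  also have "\<dots> = (\<Sum>k<?n. if (vs ! i, vs ! k) \<in> parcs G
      then card (walk_arcs (parcs G) t (vs ! k) (vs ! j)) else 0)"
    using Suc by (simp add: adjacency_matrix_index if_distrib[of "\<lambda>x. x * _"] if_distrib[of real] cong: if_cong)
  also have "\<dots> = card (walk_arcs (parcs G) (Suc t) (vs ! i) (vs ! j))"
    unfolding card_walk_arcs_Suc[OF G.pair_finite_verts parcs_subset] vs(2)[symmetric]
      sum_over_enumeration[OF vs(1)] ..
  finally show ?case .
qed

lemma trace_adjacency_matrix_pow:
  "trace_mat (adjacency_matrix G vs ^\<^sub>m t) = (\<Sum>v\<in>pverts G. card (walk_arcs (parcs G) t v v))"
  using adjacency_matrix_carrier[of G vs] adjacency_matrix_pow_index[of _ _ t]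
  by (simp add: trace_mat_def vs(2)[symmetric] sum_over_enumeration[OF vs(1)])

lemma closed_walks_eq_trace: "real (closed_walks t G) = trace_mat (adjacency_matrix G vs ^\<^sub>m t)"
proof -
  have "{(u, p). pre_digraph.awalk (with_proj G) u p u \<and> length p = t}
      = (SIGMA u:pverts G. walk_arcs (parcs G) t u u)"
    by (auto simp: pre_digraph.awalk_def walk_arcs_def cas_with_proj_eq)
  then show ?thesis
    unfolding closed_walks_def trace_adjacency_matrix_pow
    using finite_walk_arcs[OF G.pair_finite_arcs] G.pair_finite_verts by simp
qed

lemma trace_adjacency_matrix_pow_eq_0_iff:
  "trace_mat (adjacency_matrix G vs ^\<^sub>m t) = 0 \<longleftrightarrow> (\<forall>v\<in>pverts G. (v, v) \<notin> parcs G ^^ t)"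
  unfolding trace_adjacency_matrix_pow
  using finite_walk_arcs[OF G.pair_finite_arcs] G.pair_finite_verts
  by (subst of_nat_eq_0_iff) (auto simp: walk_arcs_nonempty_iff[symmetric])

lemma adjacency_matrix_symmetric: "(adjacency_matrix G vs)\<^sup>T = adjacency_matrix G vs"
  using G.arcs_symmetric by (intro eq_matI) (auto simp: adjacency_matrix_def)

end

section \<open>Odd cycles from odd closed walks\<close>

text \<open>A repeated vertex cuts the closed walk into two shorter closed walks of lengths
  \<open>j - i\<close> and \<open>m - (j - i)\<close>; one of these is odd because \<open>m\<close>
  is.\<close>

lemma odd_closed_walk_split:
  fixes f :: "nat \<Rightarrow> 'a"
  assumes odd: "odd m" and ij: "i < j" "j < m" "f i = f j"
    and walk: "f 0 = u" "f m = u" "\<And>r. r < m \<Longrightarrow> (f r, f (Suc r)) \<in> R"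
  shows "\<exists>l v. l < m \<and> odd l \<and> (v, v) \<in> R ^^ l"
proof (cases "odd (j - i)")
  case True
  have "(f i, f i) \<in> R ^^ (j - i)"
    unfolding relpow_fun_conv using ij walk by (intro exI[of _ "\<lambda>r. f (i + r)"]) auto
  with True ij show ?thesis by (intro exI[of _ "j - i"] exI[of _ "f i"]) auto
next
  case False
  have "(f 0, f i) \<in> R ^^ i" unfolding relpow_fun_conv using ij walk by (intro exI[of _ f]) auto
  moreover have "(f j, f m) \<in> R ^^ (m - j)"
    unfolding relpow_fun_conv using ij walk by (intro exI[of _ "\<lambda>r. f (j + r)"]) auto
  ultimately have "(u, u) \<in> R ^^ (i + (m - j))"
    unfolding relpow_add using ij walk by (metis relcompI)
  moreover have "i + (m - j) = m - (j - i)" using ij by simp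
  ultimately show ?thesis using odd False ij
    by (intro exI[of _ "i + (m - j)"] exI[of _ u]) auto
qed

text \<open>Strong induction on the length: a walk with a repeated vertex is replaced by a shorter
  odd one, and a walk without repetition traces a cycle.\<close>

lemma contains_cycle_if_odd_closed_walk:
  assumes G: "pair_graph G" and u: "(u, u) \<in> parcs G ^^ m" and "odd m"
  shows "\<exists>j\<ge>1. 2 * j + 1 \<le> m \<and> contains_subgraph G (cycle_graph (2 * j + 1))"
  using u \<open>odd m\<close>
proof (induction m arbitrary: u rule: less_induct)
  case (less m)
  interpret G: pair_graph G by (rule G)
  from less.prems(1) obtain f where f: "f 0 = u" "f m = u" "\<And>r. r < m \<Longrightarrow> (f r, f (Suc r)) \<in> parcs G"
    unfolding relpow_fun_conv by auto
  show ?case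
  proof (cases "inj_on f {..<m}")
    case False
    then obtain i j where "i < j" "j < m" "f i = f j"
      unfolding inj_on_def by (metis lessThan_iff linorder_neqE_nat)
    then obtain l v where "l < m" "odd l" "(v, v) \<in> parcs G ^^ l"
      using odd_closed_walk_split[OF less.prems(2) _ _ _ f] by blast
    then show ?thesis using less.IH[of l v] by fastforce
  next
    case inj: True
    have "m \<noteq> 1" using f G.no_loops'[of u u] by auto
    then obtain j where j: "m = 2 * j + 1" "1 \<le> j"
      using less.prems(2) by (metis oddE One_nat_def Suc_leI add_0 mult_0_right neq0_conv)
    then have m: "3 \<le> m" by simp
    let ?C = "cycle_graph m"
    define S where "S = \<lparr>pverts = f ` {..<m}, parcs = map_prod f f ` parcs ?C\<rparr>"
    \<comment> \<open>The index wraps around because the walk is closed,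
      \<open>f m = f 0\<close>.\<close>
    have fm: "f (Suc r mod m) = f (Suc r)" if "r < m" for r
      using f(1,2) that by (cases "Suc r = m") auto
    have arcs: "parcs S \<subseteq> parcs G"
      using f(3) fm G.arcs_symmetric unfolding S_def cycle_graph_def by fastforce
    have verts: "pverts S \<subseteq> pverts G"
      using f(3) G.in_arcsD1 unfolding S_def by fastforce
    have wfS: "wf_digraph (with_proj S)"
      by unfold_locales (auto simp: S_def cycle_graph_def)
    have "subgraph (with_proj S) (with_proj G)"
      unfolding subgraph_def using arcs verts wfS G.wf_digraph by (simp add: compatible_def)
    moreover have "digraph_iso (with_proj ?C) (with_proj S)"
      unfolding digraph_iso_def
    proof (intro exI conjI)
      let ?h = "\<lparr>iso_verts = f, iso_arcs = map_prod f f, iso_head = snd, iso_tail = fst\<rparr>"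
      have "wf_digraph (with_proj ?C)"
        by unfold_locales (auto simp: cycle_graph_def)
      moreover have "inj_on (map_prod f f) (parcs ?C)"
        by (rule inj_on_subset[OF map_prod_inj_on[OF inj inj]]) (auto simp: cycle_graph_def)
      ultimately show "pre_digraph.digraph_isomorphism (with_proj ?C) ?h"
        using inj by (auto simp: pre_digraph.digraph_isomorphism_def cycle_graph_def)
      show "with_proj S = app_iso ?h (with_proj ?C)"
        by (simp add: app_iso_def with_proj_def S_def cycle_graph_def)
    qed
    ultimately have "contains_subgraph G (cycle_graph m)" unfolding contains_subgraph_def by blast
    then show ?thesis using j by auto
  qed
qed

section \<open>Blow-ups of paths\<close>

lemma relpow_sym: "sym R \<Longrightarrow> (x, y) \<in> R ^^ t \<Longrightarrow> (y, x) \<in> R ^^ t"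
proof (induction t arbitrary: y)
  case (Suc t)
  then obtain z where "(z, x) \<in> R ^^ t" "(y, z) \<in> R" by (auto dest: symD)
  then show ?case by (rule relpow_Suc_I2[rotated])
qed simp

text \<open>The set \<open>X\<close> collects the vertices reachable by an even walk from a root
  chosen for their component. Even walks from the root to both ends of an arc would close up to an
  odd walk.\<close>

lemma bipartition_if_no_odd_closed_walk:
  assumes sym: "sym R" and no_odd: "\<And>t v. odd t \<Longrightarrow> (v, v) \<notin> R ^^ t"
  obtains X where "\<And>x y. (x, y) \<in> R \<Longrightarrow> x \<in> X \<longleftrightarrow> y \<notin> X"
proof -
  define root where "root x = (SOME z. (z, x) \<in> R\<^sup>*)" for x
  define X where "X = {x. \<exists>t. even t \<and> (root x, x) \<in> R ^^ t}"
  have root: "(root x, x) \<in> R\<^sup>*" for x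
    unfolding root_def by (rule someI[of _ x]) simp
  have X: "x \<in> X \<longleftrightarrow> y \<notin> X" if xy: "(x, y) \<in> R" for x y
  proof -
    \<comment> \<open>Both ends of an arc are reachable from the same vertices, so the choice
      operator picks the same root for them.\<close>
    have "(z, x) \<in> R\<^sup>* \<longleftrightarrow> (z, y) \<in> R\<^sup>*" for z
      using xy symD[OF sym xy] by (meson rtrancl.rtrancl_into_rtrancl)
    then have r: "root y = root x" by (simp add: root_def)
    show ?thesis
    proof
      assume "x \<in> X"
      then obtain t where t: "even t" "(root x, x) \<in> R ^^ t" by (auto simp: X_def)
      show "y \<notin> X"
      proof
        assume "y \<in> X"
        then obtain s where s: "even s" "(root x, y) \<in> R ^^ s" by (auto simp: X_def r)
        have "(root x, y) \<in> R ^^ Suc t" using t(2) xy by auto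
        moreover have "(y, root x) \<in> R ^^ s" using relpow_sym[OF sym s(2)] .
        ultimately have "(root x, root x) \<in> R ^^ (Suc t + s)"
          unfolding relpow_add by (rule relcompI)
        then show False using no_odd[of "Suc t + s"] t s by simp
      qed
    next
      assume "y \<notin> X"
      obtain t where t: "(root x, y) \<in> R ^^ t" using root[of y] unfolding r by (auto simp: rtrancl_power)
      with \<open>y \<notin> X\<close> have "odd t" by (auto simp: X_def r)
      moreover have "(root x, x) \<in> R ^^ Suc t" using t symD[OF sym xy] by auto
      ultimately show "x \<in> X" unfolding X_def by (intro CollectI exI[of _ "Suc t"]) simp
    qed
  qed
  show thesis by (rule that[OF X])
qed

section \<open>0-1 matrices with vanishing 3 by 3 minors\<close>

definition det3 :: "real \<Rightarrow> real \<Rightarrow> real \<Rightarrow> real \<Rightarrow> real \<Rightarrow> real \<Rightarrow> real \<Rightarrow> real \<Rightarrow> real \<Rightarrow> real" where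
  "det3 a b c d e f g h i = a * (e * i - f * h) - b * (d * i - f * g) + c * (d * h - e * g)"

text \<open>As in Cramer's rule, each coefficient times the determinant is a combination of the
  three relations with cofactors as weights.\<close>

lemma det3_eq_0_if_rows_dependent:
  assumes "p * a + q * d + r * g = 0" "p * b + q * e + r * h = 0" "p * c + q * f + r * i = 0"
    and nz: "p \<noteq> 0 \<or> q \<noteq> 0 \<or> r \<noteq> 0"
  shows "det3 a b c d e f g h i = 0"
proof -
  let ?d = "det3 a b c d e f g h i"
    and ?x = "p * a + q * d + r * g" and ?y = "p * b + q * e + r * h" and ?z = "p * c + q * f + r * i"
  have "p * ?d = ?x * (e * i - f * h) - ?y * (d * i - f * g) + ?z * (d * h - e * g)"
    by (simp add: det3_def algebra_simps)
  moreover have "q * ?d = - ?x * (b * i - c * h) + ?y * (a * i - c * g) - ?z * (a * h - b * g)"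
    by (simp add: det3_def algebra_simps)
  moreover have "r * ?d = ?x * (b * f - c * e) - ?y * (a * f - c * d) + ?z * (a * e - b * d)"
    by (simp add: det3_def algebra_simps)
  ultimately show ?thesis using assms by auto
qed

lemma det3_transpose: "det3 a d g b e h c f i = det3 a b c d e f g h i"
  by (simp add: det3_def algebra_simps)

text \<open>Indicator vectors of distinct nonempty sets are not proportional, so some 2 by 2 minor
  is nonzero: take a point in exactly one set and any point of the other.\<close>

lemma two_sets_independent:
  fixes V W :: "'a set"
  assumes "V \<noteq> {}" "W \<noteq> {}" "V \<noteq> W"
  obtains y z where "of_bool (y \<in> V) * of_bool (z \<in> W) \<noteq> (of_bool (z \<in> V) * of_bool (y \<in> W) :: real)"
proof -
  from assms(3) consider y where "y \<in> V" "y \<notin> W" | y where "y \<notin> V" "y \<in> W" by auto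
  then show thesis
  proof cases
    case 1
    moreover obtain z where "z \<in> W" using assms(2) by auto
    ultimately show thesis by (intro that[of y z]) simp
  next
    case 2
    moreover obtain z where "z \<in> V" using assms(1) by auto
    ultimately show thesis by (intro that[of y z]) simp
  qed
qed

text \<open>A point in only one set would extend a nonzero 2 by 2 minor of the other two, so every
  point of the union lies in at least two sets. Excluding common points of all three and showing one
  pairwise intersection empty leaves a disjoint union.\<close>

lemma three_sets_rank_2:
  fixes U V W :: "'a set"
  assumes minors: "\<And>x y z. det3 (of_bool (x \<in> U)) (of_bool (y \<in> U)) (of_bool (z \<in> U))
      (of_bool (x \<in> V)) (of_bool (y \<in> V)) (of_bool (z \<in> V))
      (of_bool (x \<in> W)) (of_bool (y \<in> W)) (of_bool (z \<in> W)) = 0"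
    and ne: "U \<noteq> {}" "V \<noteq> {}" "W \<noteq> {}" and dist: "U \<noteq> V" "V \<noteq> W" "U \<noteq> W"
  shows "U = V \<union> W \<and> V \<inter> W = {} \<or> V = U \<union> W \<and> U \<inter> W = {} \<or> W = U \<union> V \<and> U \<inter> V = {}"
proof -
  note minors = minors[unfolded det3_def]
  have U: "x \<in> V \<or> x \<in> W" if "x \<in> U" for x
  proof (rule ccontr)
    assume "\<not> (x \<in> V \<or> x \<in> W)"
    moreover obtain y z
      where "of_bool (y \<in> V) * of_bool (z \<in> W) \<noteq> (of_bool (z \<in> V) * of_bool (y \<in> W) :: real)"
      using two_sets_independent[of V W] ne dist by blast
    ultimately show False using minors[of x y z] that by simp
  qed
  have V: "x \<in> U \<or> x \<in> W" if "x \<in> V" for x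
  proof (rule ccontr)
    assume "\<not> (x \<in> U \<or> x \<in> W)"
    moreover obtain y z
      where "of_bool (y \<in> U) * of_bool (z \<in> W) \<noteq> (of_bool (z \<in> U) * of_bool (y \<in> W) :: real)"
      using two_sets_independent[of U W] ne dist by blast
    ultimately show False using minors[of x y z] that by simp
  qed
  have W: "x \<in> U \<or> x \<in> V" if "x \<in> W" for x
  proof (rule ccontr)
    assume "\<not> (x \<in> U \<or> x \<in> V)"
    moreover obtain y z
      where "of_bool (y \<in> U) * of_bool (z \<in> V) \<noteq> (of_bool (z \<in> U) * of_bool (y \<in> V) :: real)"
      using two_sets_independent[of U V] ne dist by blast
    ultimately show False using minors[of x y z] that by simp
  qed
  have not_all: "x \<notin> U \<inter> V \<inter> W" for x
  proof
    assume x: "x \<in> U \<inter> V \<inter> W"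
    \<comment> \<open>Together with a common point, points of two different pairwise regions would
      give a nonsingular minor. Hence two of the three regions are empty, and two of the sets
      coincide.\<close>
    have no: "\<not> (y \<in> U \<inter> V - W \<and> z \<in> U \<inter> W - V)" "\<not> (y \<in> U \<inter> V - W \<and> z \<in> V \<inter> W - U)"
      "\<not> (y \<in> U \<inter> W - V \<and> z \<in> V \<inter> W - U)" for y z
      using x minors[of x y z] by auto
    have "U \<inter> V - W = {} \<or> U \<inter> W - V = {}" using no(1) by blast
    moreover have "U \<inter> V - W = {} \<or> V \<inter> W - U = {}" using no(2) by blast
    moreover have "U \<inter> W - V = {} \<or> V \<inter> W - U = {}" using no(3) by blast
    ultimately consider "U \<inter> V - W = {}" "U \<inter> W - V = {}" | "U \<inter> V - W = {}" "V \<inter> W - U = {}"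
      | "U \<inter> W - V = {}" "V \<inter> W - U = {}" by argo
    then show False
    proof cases
      case 1
      then have "V \<subseteq> W" "W \<subseteq> V" using U V W by blast+
      then show False using dist by simp
    next
      case 2
      then have "U \<subseteq> W" "W \<subseteq> U" using U V W by blast+
      then show False using dist by simp
    next
      case 3
      then have "U \<subseteq> V" "V \<subseteq> U" using U V W by blast+
      then show False using dist by simp
    qed
  qed
  \<comment> \<open>With one point in each pairwise region, the minor would be
    \<open>-2\<close>.\<close>
  have "\<not> (x \<in> U \<inter> V - W \<and> y \<in> U \<inter> W - V \<and> z \<in> V \<inter> W - U)" for x y z
  proof
    assume "x \<in> U \<inter> V - W \<and> y \<in> U \<inter> W - V \<and> z \<in> V \<inter> W - U"
    then show False using minors[of x y z] by simp
  qed
  then consider "U \<inter> V - W = {}" | "U \<inter> W - V = {}" | "V \<inter> W - U = {}" by blast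
  then show ?thesis
  proof cases
    case 1
    then have "W = U \<union> V \<and> U \<inter> V = {}" using U V W not_all by blast
    then show ?thesis by simp
  next
    case 2
    then have "V = U \<union> W \<and> U \<inter> W = {}" using U V W not_all by blast
    then show ?thesis by simp
  next
    case 3
    then have "U = V \<union> W \<and> V \<inter> W = {}" using U V W not_all by blast
    then show ?thesis by simp
  qed
qed

text \<open>If \<open>F\<close> contains disjoint \<open>S\<close> and \<open>T\<close> together
  with their union, a fourth member would break the three-set condition with \<open>S\<close> and
  \<open>T\<close>. Otherwise \<open>F\<close> has no three distinct members.\<close>

lemma sum_closed_set_family:
  fixes F :: "'a set set"
  assumes ne: "{} \<notin> F"
    and three: "\<And>U V W. U \<in> F \<Longrightarrow> V \<in> F \<Longrightarrow> W \<in> F \<Longrightarrow> U \<noteq> V \<Longrightarrow> V \<noteq> W \<Longrightarrow> U \<noteq> W \<Longrightarrow>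
      U = V \<union> W \<and> V \<inter> W = {} \<or> V = U \<union> W \<and> U \<inter> W = {} \<or> W = U \<union> V \<and> U \<inter> V = {}"
  obtains S T where "F \<subseteq> {S, T}"
    | S T where "S \<noteq> {}" "T \<noteq> {}" "S \<inter> T = {}" "F \<subseteq> {S, T, S \<union> T}"
proof (cases "\<exists>S\<in>F. \<exists>T\<in>F. S \<union> T \<in> F \<and> S \<inter> T = {}")
  case True
  then obtain S T where ST: "S \<in> F" "T \<in> F" "S \<union> T \<in> F" "S \<inter> T = {}" by auto
  then have ne': "S \<noteq> {}" "T \<noteq> {}" using ne by auto
  have "Z \<in> {S, T, S \<union> T}" if "Z \<in> F" for Z
  proof (rule ccontr)
    assume Z: "Z \<notin> {S, T, S \<union> T}"
    have neq: "S \<noteq> T" "T \<noteq> Z" "S \<noteq> Z" using ST ne' Z by auto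
    have "S = T \<union> Z \<and> T \<inter> Z = {} \<or> T = S \<union> Z \<and> S \<inter> Z = {} \<or> Z = S \<union> T \<and> S \<inter> T = {}"
      by (rule three[OF ST(1,2) that neq])
    then show False using ST(4) ne' Z by blast
  qed
  then show thesis using that(2)[OF ne' ST(4)] by blast
next
  case False
  have no3: "U = V \<or> V = W \<or> U = W" if UVW: "U \<in> F" "V \<in> F" "W \<in> F" for U V W
  proof (rule ccontr)
    assume "\<not> (U = V \<or> V = W \<or> U = W)"
    then consider "U = V \<union> W" "V \<inter> W = {}" | "V = U \<union> W" "U \<inter> W = {}" | "W = U \<union> V" "U \<inter> V = {}"
      using three[OF UVW] by auto
    then show False
    proof cases
      case 1
      then show False using UVW \<open>\<not> (\<exists>S\<in>F. \<exists>T\<in>F. S \<union> T \<in> F \<and> S \<inter> T = {})\<close> by auto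
    next
      case 2
      then show False using UVW \<open>\<not> (\<exists>S\<in>F. \<exists>T\<in>F. S \<union> T \<in> F \<and> S \<inter> T = {})\<close> by auto
    next
      case 3
      then show False using UVW \<open>\<not> (\<exists>S\<in>F. \<exists>T\<in>F. S \<union> T \<in> F \<and> S \<inter> T = {})\<close> by auto
    qed
  qed
  show thesis
  proof (cases "\<exists>S\<in>F. \<exists>T\<in>F. S \<noteq> T")
    case True
    then obtain S T where "S \<in> F" "T \<in> F" "S \<noteq> T" by auto
    then show thesis using no3 by (intro that(1)[of S T]) blast
  next
    case all_eq: False
    show thesis
    proof (cases "F = {}")
      case True
      then show thesis by (intro that(1)[of "{}" "{}"]) simp
    next
      case False
      then obtain S where "S \<in> F" by auto
      then show thesis using all_eq by (intro that(1)[of S S]) auto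
    qed
  qed
qed

text \<open>Blow-ups of \<open>H\<close> are the graphs with a full homomorphism to \<open>H\<close>, whose fibres are the stable sets.\<close>
lemma is_blow_up_iff_full_hom:
  assumes G: "parcs G \<subseteq> pverts G \<times> pverts G" and H: "parcs H \<subseteq> pverts H \<times> pverts H"
  shows "is_blow_up G H \<longleftrightarrow> (\<exists>c. (\<forall>x\<in>pverts G. c x \<in> pverts H) \<and>
    (\<forall>x\<in>pverts G. \<forall>y\<in>pverts G. (x, y) \<in> parcs G \<longleftrightarrow> (c x, c y) \<in> parcs H))"
    (is "_ \<longleftrightarrow> (\<exists>c. ?hom c)")
proof
  assume "is_blow_up G H"
  then obtain I where I: "disjoint_family_on I (pverts H)" "pverts G = (\<Union>v\<in>pverts H. I v)"
    "parcs G = (\<Union>(u, v)\<in>parcs H. I u \<times> I v)"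
    unfolding is_blow_up_def by auto
  define c where "c x = (SOME v. v \<in> pverts H \<and> x \<in> I v)" for x
  have c: "c x \<in> pverts H" "x \<in> I (c x)" if "x \<in> pverts G" for x
    using that someI_ex[of "\<lambda>v. v \<in> pverts H \<and> x \<in> I v"] unfolding c_def I(2) by auto
  have uniq: "u = c x" if "u \<in> pverts H" "x \<in> I u" for u x
  proof (rule ccontr)
    assume "u \<noteq> c x"
    moreover have "x \<in> pverts G" using that I(2) by auto
    ultimately show False using I(1) c[of x] that unfolding disjoint_family_on_def by blast
  qed
  have "(x, y) \<in> parcs G \<longleftrightarrow> (c x, c y) \<in> parcs H" if "x \<in> pverts G" "y \<in> pverts G" for x y
  proof
    assume "(x, y) \<in> parcs G"
    then obtain u v where "(u, v) \<in> parcs H" "x \<in> I u" "y \<in> I v" unfolding I(3) by auto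
    then show "(c x, c y) \<in> parcs H" using uniq[of u x] uniq[of v y] H by auto
  next
    assume "(c x, c y) \<in> parcs H"
    then show "(x, y) \<in> parcs G" unfolding I(3) using c that by auto
  qed
  then show "\<exists>c. ?hom c" using c by blast
next
  assume "\<exists>c. ?hom c"
  then obtain c where c: "?hom c" by blast
  show "is_blow_up G H"
    unfolding is_blow_up_def
  proof (intro exI conjI)
    let ?I = "\<lambda>v. {x \<in> pverts G. c x = v}"
    show "disjoint_family_on ?I (pverts H)" by (auto simp: disjoint_family_on_def)
    show "pverts G = (\<Union>v\<in>pverts H. ?I v)" using c by auto
    show "parcs G = (\<Union>(u, v)\<in>parcs H. ?I u \<times> ?I v)"
    proof (intro subset_antisym subsetI)
      fix e assume e: "e \<in> parcs G"
      obtain x y where xy: "e = (x, y)" by fastforce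
      then have "(c x, c y) \<in> parcs H" using c e G by auto
      then show "e \<in> (\<Union>(u, v)\<in>parcs H. ?I u \<times> ?I v)" using e xy G
        by (intro UN_I[of "(c x, c y)"]) auto
    qed (use c in auto)
  qed
qed

text \<open>Adjacency in \<open>P\<^sub>5 \<union> K\<^sub>1\<close>, where every number from 5 on stands for the vertex of \<open>K\<^sub>1\<close>.\<close>
definition path5_adj :: "nat \<Rightarrow> nat \<Rightarrow> bool" where
  "path5_adj i j \<longleftrightarrow> i < 5 \<and> j < 5 \<and> (j = Suc i \<or> i = Suc j)"

lemma path5_adj_commute: "path5_adj i j \<longleftrightarrow> path5_adj j i"
  by (auto simp: path5_adj_def)

text \<open>A full homomorphism to \<open>H\<close> is composed with a map \<open>h\<close> that
  preserves and reflects adjacency.\<close>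

lemma path5_coloring_if_blow_up:
  assumes bu: "is_blow_up G H" and G: "parcs G \<subseteq> pverts G \<times> pverts G"
    and H: "parcs H \<subseteq> pverts H \<times> pverts H"
    and h: "\<And>u v. u \<in> pverts H \<Longrightarrow> v \<in> pverts H \<Longrightarrow> path5_adj (h u) (h v) \<longleftrightarrow> (u, v) \<in> parcs H"
  shows "\<exists>c. \<forall>x\<in>pverts G. \<forall>y\<in>pverts G. (x, y) \<in> parcs G \<longleftrightarrow> path5_adj (c x) (c y)"
proof -
  from bu obtain c where c: "\<forall>x\<in>pverts G. c x \<in> pverts H"
    "\<forall>x\<in>pverts G. \<forall>y\<in>pverts G. (x, y) \<in> parcs G \<longleftrightarrow> (c x, c y) \<in> parcs H"
    unfolding is_blow_up_iff_full_hom[OF G H] by blast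
  then show ?thesis by (intro exI[of _ "h \<circ> c"]) (simp add: h)
qed

lemma blow_up_of_path_unions_iff:
  assumes G: "parcs G \<subseteq> pverts G \<times> pverts G"
  shows "is_blow_up G (disjoint_union (path_graph 2) (complete_graph 1)) \<or>
      is_blow_up G (disjoint_union (disjoint_copies 2 (path_graph 2)) (complete_graph 1)) \<or>
      is_blow_up G (disjoint_union (path_graph 4) (complete_graph 1)) \<or>
      is_blow_up G (disjoint_union (path_graph 5) (complete_graph 1))
    \<longleftrightarrow> (\<exists>c. \<forall>x\<in>pverts G. \<forall>y\<in>pverts G. (x, y) \<in> parcs G \<longleftrightarrow> path5_adj (c x) (c y))"
    (is "?P2 \<or> ?PP \<or> ?P4 \<or> ?P5 \<longleftrightarrow> ?C")
proof
  assume "?P2 \<or> ?PP \<or> ?P4 \<or> ?P5"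
  then consider ?P2 | ?PP | ?P4 | ?P5 by blast
  then show ?C
  proof cases
    case 1
    show ?thesis
      by (rule path5_coloring_if_blow_up[OF 1 G, of "case_sum id (\<lambda>_. 5)"])
        (auto simp: disjoint_union_def path_graph_def complete_graph_def path5_adj_def)
  next
    case 2
    \<comment> \<open>The two copies of \<open>P\<^sub>2\<close> go to the pairs 0, 1 and 3, 4,
      leaving out the middle vertex 2; 5 represents \<open>K\<^sub>1\<close>.\<close>
    show ?thesis
      by (rule path5_coloring_if_blow_up[OF 2 G, of "case_sum (\<lambda>(k, i). 3 * k + i) (\<lambda>_. 5)"])
        (auto simp: disjoint_union_def disjoint_copies_def path_graph_def complete_graph_def
          path5_adj_def less_2_cases_iff)
  next
    case 3
    show ?thesis
      by (rule path5_coloring_if_blow_up[OF 3 G, of "case_sum id (\<lambda>_. 5)"])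
        (auto simp: disjoint_union_def path_graph_def complete_graph_def path5_adj_def)
  next
    case 4
    show ?thesis
      by (rule path5_coloring_if_blow_up[OF 4 G, of "case_sum id (\<lambda>_. 5)"])
        (auto simp: disjoint_union_def path_graph_def complete_graph_def path5_adj_def)
  qed
next
  assume ?C
  then obtain c where c: "\<forall>x\<in>pverts G. \<forall>y\<in>pverts G. (x, y) \<in> parcs G \<longleftrightarrow> path5_adj (c x) (c y)"
    by blast
  let ?H = "disjoint_union (path_graph 5) (complete_graph 1)"
  let ?c = "\<lambda>x. if c x < 5 then Inl (c x) else Inr 0"
  have H: "parcs ?H \<subseteq> pverts ?H \<times> pverts ?H"
    by (auto simp: disjoint_union_def path_graph_def complete_graph_def)
  have "?c x \<in> pverts ?H" for x
    by (auto simp: disjoint_union_def path_graph_def complete_graph_def)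
  moreover have "(?c x, ?c y) \<in> parcs ?H \<longleftrightarrow> path5_adj (c x) (c y)" for x y
    by (auto simp: disjoint_union_def path_graph_def complete_graph_def path5_adj_def)
  ultimately have ?P5
    unfolding is_blow_up_iff_full_hom[OF G H] using c by (intro exI[of _ ?c]) simp
  then show "?P2 \<or> ?PP \<or> ?P4 \<or> ?P5" by simp
qed

text \<open>The edges of \<open>P\<^sub>5\<close> split into the stars at 1 and at 3; each star, in
  its two orientations, gives two products of indicators.\<close>

lemma path5_adj_rank_4:
  "of_bool (path5_adj i j) = (\<Sum>l<4. of_bool (i \<in> [{1}, {0, 2}, {3}, {2, 4}] ! l)
    * of_bool (j \<in> [{0, 2}, {1}, {2, 4}, {3}] ! l) :: real)"
proof -
  have S: "(\<Sum>l<4. g l) = g 0 + g 1 + g 2 + g 3" for g :: "nat \<Rightarrow> real"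
    by (simp add: numeral_eq_Suc)
  have five: "m < 5 \<longleftrightarrow> m \<in> {0, 1, 2, 3, 4}" for m :: nat by auto
  show ?thesis
    unfolding S path5_adj_def five by auto
qed

text \<open>Vertices of \<open>X\<close> are coloured by their neighbourhoods, the other vertices by
  their membership in the sets \<open>S\<close> and \<open>T\<close> describing these
  neighbourhoods.\<close>

lemma path5_coloring_if_bipartite_rank_4:
  fixes R :: "'a rel"
  assumes sym: "sym R" and X: "\<And>x y. (x, y) \<in> R \<Longrightarrow> x \<in> X \<longleftrightarrow> y \<notin> X"
    and minors: "\<And>u v w x y z. u \<in> X \<Longrightarrow> v \<in> X \<Longrightarrow> w \<in> X \<Longrightarrow>
      R `` {u} \<noteq> {} \<Longrightarrow> R `` {v} \<noteq> {} \<Longrightarrow> R `` {w} \<noteq> {} \<Longrightarrow> u \<noteq> v \<Longrightarrow> v \<noteq> w \<Longrightarrow> u \<noteq> w \<Longrightarrow>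
      det3 (of_bool ((u, x) \<in> R)) (of_bool ((u, y) \<in> R)) (of_bool ((u, z) \<in> R))
        (of_bool ((v, x) \<in> R)) (of_bool ((v, y) \<in> R)) (of_bool ((v, z) \<in> R))
        (of_bool ((w, x) \<in> R)) (of_bool ((w, y) \<in> R)) (of_bool ((w, z) \<in> R)) = 0"
  shows "\<exists>c. \<forall>x y. (x, y) \<in> R \<longleftrightarrow> path5_adj (c x) (c y)"
proof -
  have symm: "(x, y) \<in> R \<longleftrightarrow> (y, x) \<in> R" for x y using sym by (auto dest: symD)
  have extend: ?thesis
    if "\<And>x y. x \<in> X \<Longrightarrow> y \<notin> X \<Longrightarrow> (x, y) \<in> R \<longleftrightarrow> path5_adj (c x) (c y)"
      and "\<And>x y. x \<in> X \<longleftrightarrow> y \<in> X \<Longrightarrow> \<not> path5_adj (c x) (c y)" for c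
    using that X symm path5_adj_commute by (intro exI[of _ c]) metis
  let ?F = "{N. N \<noteq> {} \<and> (\<exists>x\<in>X. N = R `` {x})}"
  have F: "R `` {x} = {} \<or> R `` {x} \<in> ?F" if "x \<in> X" for x using that by auto
  have ne: "{} \<notin> ?F" by simp
  have three: "U = V \<union> W \<and> V \<inter> W = {} \<or> V = U \<union> W \<and> U \<inter> W = {} \<or> W = U \<union> V \<and> U \<inter> V = {}"
    if "U \<in> ?F" "V \<in> ?F" "W \<in> ?F" "U \<noteq> V" "V \<noteq> W" "U \<noteq> W" for U V W
  proof -
    from that(1-3) obtain u v w where u: "u \<in> X" "U = R `` {u}" and v: "v \<in> X" "V = R `` {v}"
      and w: "w \<in> X" "W = R `` {w}" by auto
    then have "u \<noteq> v" "v \<noteq> w" "u \<noteq> w" using that by auto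
    with that u v w show ?thesis
      by (intro three_sets_rank_2) (simp_all add: minors)
  qed
  consider S T where "?F \<subseteq> {S, T}"
    | S T where "S \<noteq> {}" "T \<noteq> {}" "S \<inter> T = {}" "?F \<subseteq> {S, T, S \<union> T}"
    by (rule sum_closed_set_family[OF ne three])
  then show ?thesis
  proof cases
    case (1 S T)
    show ?thesis
    proof (rule extend)
      \<comment> \<open>Neighbourhoods \<open>S\<close> and \<open>T\<close> receive the star
        centres 1 and 3; opposite vertices go to 2 if they lie in both sets, to 0 or 4 if in one,
        and to 5 if in none.\<close>
      let ?c = "\<lambda>x. if x \<in> X then if R `` {x} = {} then 5 else if R `` {x} = S then 1 else 3
        else if x \<in> S then if x \<in> T then 2 else 0 else if x \<in> T then 4 else (5 :: nat)"
      show "\<not> path5_adj (?c x) (?c y)" if "x \<in> X \<longleftrightarrow> y \<in> X" for x y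
        using that by (auto simp: path5_adj_def)
      show "(x, y) \<in> R \<longleftrightarrow> path5_adj (?c x) (?c y)" if "x \<in> X" "y \<notin> X" for x y
      proof -
        consider "R `` {x} = {}" | "R `` {x} \<noteq> {}" "R `` {x} = S" | "R `` {x} \<noteq> {}" "R `` {x} \<noteq> S" "R `` {x} = T"
          using F[OF \<open>x \<in> X\<close>] 1 by blast
        moreover have "(x, y) \<in> R \<longleftrightarrow> y \<in> R `` {x}" by simp
        ultimately show ?thesis using that by cases (simp_all add: path5_adj_def)
      qed
    qed
  next
    case (2 S T)
    show ?thesis
    proof (rule extend)
      \<comment> \<open>Now the neighbourhoods take the even positions: \<open>S\<close> at 0,
        \<open>T\<close> at 4 and \<open>S \<union> T\<close> at 2, between the colours 1 and 3 of
        the points of \<open>S\<close> and \<open>T\<close>.\<close>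
      let ?c = "\<lambda>x. if x \<in> X then if R `` {x} = {} then 5 else if R `` {x} = S then 0
          else if R `` {x} = T then 4 else 2
        else if x \<in> S then 1 else if x \<in> T then 3 else (5 :: nat)"
      show "\<not> path5_adj (?c x) (?c y)" if "x \<in> X \<longleftrightarrow> y \<in> X" for x y
        using that by (auto simp: path5_adj_def)
      show "(x, y) \<in> R \<longleftrightarrow> path5_adj (?c x) (?c y)" if "x \<in> X" "y \<notin> X" for x y
      proof -
        consider "R `` {x} = {}" | "R `` {x} \<noteq> {}" "R `` {x} = S" | "R `` {x} \<noteq> {}" "R `` {x} \<noteq> S" "R `` {x} = T"
          | "R `` {x} \<noteq> {}" "R `` {x} \<noteq> S" "R `` {x} \<noteq> T" "R `` {x} = S \<union> T"
          using F[OF \<open>x \<in> X\<close>] 2(4) by blast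
        moreover have "(x, y) \<in> R \<longleftrightarrow> y \<in> R `` {x}" by simp
        moreover have "\<not> (y \<in> S \<and> y \<in> T)" using 2(3) by blast
        ultimately show ?thesis using that by cases (simp_all add: path5_adj_def)
      qed
    qed
  qed
qed

section \<open>Eigenvalues and blow-ups\<close>

text \<open>A real Schur decomposition puts the roots of the characteristic polynomial on the
  diagonal of \<open>B\<close>, where both power traces and rank bounds can be read off.\<close>

lemma eigenvalue_list_triangular:
  fixes A :: "real mat"
  assumes A: "A \<in> carrier_mat n n" and sym: "A\<^sup>T = A"
  obtains B P Q where "similar_mat_wit A B P Q" "upper_triangular B"
    "mset (eigenvalue_list A) = mset (map (\<lambda>i. B $$ (i, i)) [0..<n])"
proof -
  from char_poly_splits_if_real_symmetric[OF A sym]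
  obtain es where es: "char_poly A = (\<Prod>e\<leftarrow>es. [:- e, 1:])" "length es = n" .
  obtain B P Q where "schur_decomposition A es = (B, P, Q)" by (metis prod_cases3)
  from schur_decomposition[OF A es(1) this]
  have B: "similar_mat_wit A B P Q" "upper_triangular B" "diag_mat B = es" by auto
  have "proots (\<Prod>e\<leftarrow>xs. [:- e, 1:]) = mset xs" for xs :: "real list"
  proof (induction xs)
    case (Cons x xs)
    have "(\<Prod>e\<leftarrow>xs. [:- e, 1:]) \<noteq> (0 :: real poly)" by (auto simp: prod_list_zero_iff)
    then show ?case using Cons by (simp add: proots_mult del: mult_pCons_left)
  qed simp
  then have "mset (eigenvalue_list A) = mset es" by (simp add: eigenvalue_list_def es(1))
  moreover have "es = map (\<lambda>i. B $$ (i, i)) [0..<n]"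
    using B(3) similar_mat_witD2(5)[OF A B(1)] by (simp add: diag_mat_def)
  ultimately show thesis using that B by metis
qed

lemma sum_nth_eq_if_mset_eq:
  fixes f :: "'a \<Rightarrow> 'b :: comm_monoid_add"
  assumes "mset xs = mset (map g [0..<n])"
  shows "(\<Sum>i<n. f (xs ! i)) = (\<Sum>i<n. f (g i))"
proof -
  have len: "length xs = n" using mset_eq_length[OF assms] by simp
  have "(\<Sum>i<n. f (xs ! i)) = sum_list (map f xs)"
    by (simp add: sum_list_sum_nth len atLeast0LessThan)
  also have "\<dots> = sum_mset (image_mset f (mset (map g [0..<n])))"
    unfolding assms[symmetric] by (simp add: sum_mset_sum_list[symmetric])
  also have "\<dots> = sum_list (map f (map g [0..<n]))"
    by (simp only: sum_mset_sum_list[symmetric] mset_map)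
  also have "\<dots> = (\<Sum>i<n. f (g i))" by (simp add: sum_list_sum_nth atLeast0LessThan)
  finally show ?thesis .
qed

lemma card_eq_if_mset_eq:
  assumes "mset xs = mset (map g [0..<n])"
  shows "card {i\<in>{..<n}. P (xs ! i)} = card {i\<in>{..<n}. P (g i)}"
  using sum_nth_eq_if_mset_eq[OF assms, of "\<lambda>x. if P x then 1 else 0 :: nat"]
  by (simp add: sum.If_cases Int_def)

section \<open>At most four nonzero eigenvalues and colourings by \<open>P\<^sub>5\<close>\<close>

context
  fixes G :: "'a pair_pre_digraph" and vs :: "'a list" and B P Q :: "real mat"
  assumes G: "pair_graph G" and vs: "distinct vs" "set vs = pverts G"
    and sim: "similar_mat_wit (adjacency_matrix G vs) B P Q" and ut: "upper_triangular B"
begin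

interpretation G: pair_graph G by (rule G)

lemma vertex_relation:
  assumes T: "T \<subseteq> pverts G" and card: "card {i\<in>{..<length vs}. B $$ (i, i) \<noteq> 0} < card T"
  obtains c :: "'a \<Rightarrow> real"
  where "\<exists>v\<in>T. c v \<noteq> 0" "\<And>w. w \<in> pverts G \<Longrightarrow> (\<Sum>v\<in>T. c v * of_bool ((v, w) \<in> parcs G)) = 0"
proof -
  define S where "S = {i. i < length vs \<and> vs ! i \<in> T}"
  have bij: "bij_betw ((!) vs) S T"
    using T vs unfolding bij_betw_def S_def
    by (auto simp: inj_on_def nth_eq_iff_index_eq in_set_conv_nth image_iff subset_iff) (metis in_set_conv_nth)
  have S: "S \<subseteq> {..<length vs}" by (auto simp: S_def)
  have cardS: "card S = card T" using bij by (rule bij_betw_same_card)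
  obtain c where c: "\<exists>s\<in>S. c s \<noteq> 0"
    "\<And>j. j < length vs \<Longrightarrow> (\<Sum>s\<in>S. c s * adjacency_matrix G vs $$ (s, j)) = 0"
    using symmetric_rows_dependent[OF adjacency_matrix_carrier adjacency_matrix_symmetric[OF G vs] sim ut S]
      card cardS by metis
  define d where "d = c \<circ> the_inv_into S ((!) vs)"
  have d: "d (vs ! i) = c i" if "i \<in> S" for i
    using that bij by (simp add: d_def the_inv_into_f_f bij_betw_def)
  show thesis
  proof (rule that[of d])
    show "\<exists>v\<in>T. d v \<noteq> 0" using c(1) d bij by (metis bij_betwE)
    fix w assume "w \<in> pverts G"
    then obtain j where j: "j < length vs" "w = vs ! j" using vs(2) by (metis in_set_conv_nth)
    have "(\<Sum>v\<in>T. d v * of_bool ((v, w) \<in> parcs G))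
        = (\<Sum>s\<in>S. d (vs ! s) * of_bool ((vs ! s, w) \<in> parcs G))"
      by (rule sum.reindex_bij_betw[OF bij, symmetric])
    also have "\<dots> = (\<Sum>s\<in>S. c s * adjacency_matrix G vs $$ (s, j))"
      using S j by (intro sum.cong refl) (auto simp: d adjacency_matrix_index)
    finally show "(\<Sum>v\<in>T. d v * of_bool ((v, w) \<in> parcs G)) = 0" using c(2)[OF j(1)] by simp
  qed
qed

text \<open>Six rows of a matrix with at most four nonzero eigenvalues satisfy a nontrivial
  relation. Bipartiteness separates it into a relation among the rows of the minor and one among its
  columns, and one of the two is nontrivial.\<close>

lemma biadjacency_minors_vanish:
  assumes card: "card {i\<in>{..<length vs}. B $$ (i, i) \<noteq> 0} \<le> 4"
    and X: "\<And>x y. (x, y) \<in> parcs G \<Longrightarrow> x \<in> X \<longleftrightarrow> y \<notin> X"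
    and uvw: "u \<in> X" "v \<in> X" "w \<in> X" "u \<in> pverts G" "v \<in> pverts G" "w \<in> pverts G"
      "u \<noteq> v" "v \<noteq> w" "u \<noteq> w"
  shows "det3 (of_bool ((u, x) \<in> parcs G)) (of_bool ((u, y) \<in> parcs G)) (of_bool ((u, z) \<in> parcs G))
    (of_bool ((v, x) \<in> parcs G)) (of_bool ((v, y) \<in> parcs G)) (of_bool ((v, z) \<in> parcs G))
    (of_bool ((w, x) \<in> parcs G)) (of_bool ((w, y) \<in> parcs G)) (of_bool ((w, z) \<in> parcs G)) = 0"
proof (cases "x \<notin> X \<and> y \<notin> X \<and> z \<notin> X \<and> {x, y, z} \<subseteq> pverts G \<and> x \<noteq> y \<and> y \<noteq> z \<and> x \<noteq> z")
  \<comment> \<open>In the degenerate case the minor has a zero column or two equal columns.\<close>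
  case False
  then consider "x \<in> X \<or> x \<notin> pverts G" | "y \<in> X \<or> y \<notin> pverts G" | "z \<in> X \<or> z \<notin> pverts G"
    | "x = y" | "y = z" | "x = z" by auto
  moreover have "(a, b) \<notin> parcs G" if "a \<in> X" "b \<in> X \<or> b \<notin> pverts G" for a b
    using X that G.in_arcsD2 by blast
  ultimately show ?thesis using uvw by cases (simp_all add: det3_def)
next
  case True
  then have xyz: "x \<notin> X" "y \<notin> X" "z \<notin> X" "x \<in> pverts G" "y \<in> pverts G" "z \<in> pverts G"
    "x \<noteq> y" "y \<noteq> z" "x \<noteq> z" by auto
  let ?a = "\<lambda>p q. of_bool ((p, q) \<in> parcs G) :: real"
  have ne: "u \<noteq> x" "u \<noteq> y" "u \<noteq> z" "v \<noteq> x" "v \<noteq> y" "v \<noteq> z" "w \<noteq> x" "w \<noteq> y" "w \<noteq> z"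
    using uvw xyz by metis+
  have cardT: "card {u, v, w, x, y, z} = 6" using uvw xyz ne by simp
  have sub: "{u, v, w, x, y, z} \<subseteq> pverts G" using uvw xyz by simp
  have less: "card {i\<in>{..<length vs}. B $$ (i, i) \<noteq> 0} < card {u, v, w, x, y, z}"
    using card cardT by simp
  obtain c where c: "\<exists>s\<in>{u, v, w, x, y, z}. c s \<noteq> 0"
    "\<And>q. q \<in> pverts G \<Longrightarrow> (\<Sum>s\<in>{u, v, w, x, y, z}. c s * ?a s q) = 0"
    by (rule vertex_relation[OF sub less]) (rule that)
  have S: "(\<Sum>s\<in>{u, v, w, x, y, z}. c s * ?a s q)
      = c u * ?a u q + c v * ?a v q + c w * ?a w q + (c x * ?a x q + c y * ?a y q + c z * ?a z q)" for q
    using uvw xyz ne by simp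
  have 0: "?a p q = 0" if "p \<in> X \<longleftrightarrow> q \<in> X" for p q using X that by auto
  have rows: "c u * ?a u q + c v * ?a v q + c w * ?a w q = 0" if "q \<notin> X" "q \<in> pverts G" for q
    using c(2)[OF that(2)] 0[of x q] 0[of y q] 0[of z q] that xyz unfolding S by simp
  have cols: "c x * ?a q x + c y * ?a q y + c z * ?a q z = 0" if "q \<in> X" "q \<in> pverts G" for q
  proof -
    have "c x * ?a x q + c y * ?a y q + c z * ?a z q = 0"
      using c(2)[OF that(2)] 0[of u q] 0[of v q] 0[of w q] that uvw unfolding S by simp
    moreover have "?a p q = ?a q p" for p using G.arcs_symmetric by auto
    ultimately show ?thesis by simp
  qed
  show ?thesis
  proof (cases "c u \<noteq> 0 \<or> c v \<noteq> 0 \<or> c w \<noteq> 0")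
    case True
    show ?thesis
      by (rule det3_eq_0_if_rows_dependent[OF rows rows rows True]) (use xyz in simp_all)
  next
    case False
    then have nz: "c x \<noteq> 0 \<or> c y \<noteq> 0 \<or> c z \<noteq> 0" using c(1) by auto
    show ?thesis
      by (subst det3_transpose[symmetric], rule det3_eq_0_if_rows_dependent[OF cols cols cols nz])
        (use uvw in simp_all)
  qed
qed

lemma path5_coloring_if_four_nonzero_eigenvalues:
  assumes card: "card {i\<in>{..<length vs}. B $$ (i, i) \<noteq> 0} \<le> 4"
    and odd: "\<And>t. odd t \<Longrightarrow> trace_mat (adjacency_matrix G vs ^\<^sub>m t) = 0"
  shows "\<exists>c. \<forall>x\<in>pverts G. \<forall>y\<in>pverts G. (x, y) \<in> parcs G \<longleftrightarrow> path5_adj (c x) (c y)"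
proof -
  have sym: "sym (parcs G)" using G.arcs_symmetric by (auto intro: symI)
  have "(v, v) \<notin> parcs G ^^ t" if t: "odd t" for t v
  proof
    assume v: "(v, v) \<in> parcs G ^^ t"
    \<comment> \<open>An odd length is positive, so the walk has a first arc and \<open>v\<close> is
      a vertex.\<close>
    from t obtain s where "t = Suc s" by (metis oddE Suc_eq_plus1)
    then have "v \<in> pverts G" using v relpow_Suc_D2[of v v s] G.in_arcsD1 by blast
    then show False using v odd[OF t] trace_adjacency_matrix_pow_eq_0_iff[OF G vs] by blast
  qed
  then obtain X where X: "\<And>x y. (x, y) \<in> parcs G \<Longrightarrow> x \<in> X \<longleftrightarrow> y \<notin> X"
    using bipartition_if_no_odd_closed_walk[OF sym] by metis
  have "\<exists>c. \<forall>x y. (x, y) \<in> parcs G \<longleftrightarrow> path5_adj (c x) (c y)"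
    using G.in_arcsD1
    by (intro path5_coloring_if_bipartite_rank_4[OF sym X] biadjacency_minors_vanish[OF card X]) blast+
  then show ?thesis by blast
qed

lemma four_nonzero_eigenvalues_if_path5_coloring:
  assumes c: "\<forall>x\<in>pverts G. \<forall>y\<in>pverts G. (x, y) \<in> parcs G \<longleftrightarrow> path5_adj (c x) (c y)"
  shows "card {i\<in>{..<length vs}. B $$ (i, i) \<noteq> 0} \<le> 4"
proof -
  have "adjacency_matrix G vs $$ (i, j) = of_bool (path5_adj (c (vs ! i)) (c (vs ! j)))"
    if "i < length vs" "j < length vs" for i j
    using c that vs(2) by (auto simp: adjacency_matrix_index dest: nth_mem)
  then have "adjacency_matrix G vs $$ (i, j)
      = (\<Sum>l<4. of_bool (c (vs ! i) \<in> [{1}, {0, 2}, {3}, {2, 4}] ! l)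
        * of_bool (c (vs ! j) \<in> [{0, 2}, {1}, {2, 4}, {3}] ! l))"
    if "i < length vs" "j < length vs" for i j
    using that by (simp only: path5_adj_rank_4)
  from card_nonzero_diag_le_if_factorization[OF adjacency_matrix_carrier sim ut _ this]
  show ?thesis by simp
qed

end

theorem theorem1p1:
  fixes G :: "'a pair_pre_digraph" and vs :: "'a list" and k :: nat
  assumes "k > 0"
    and "pair_graph G"
    and "card (pverts G) \<ge> 2 * k + 1"
    and "distinct vs" and "set vs = pverts G"
    and "\<forall>j \<in> {1..k}. \<not> contains_subgraph G (cycle_graph (2 * j + 1))"
  shows "nth_eigenvalue (adjacency_matrix G vs) 1 ^ (2 * k)
           + nth_eigenvalue (adjacency_matrix G vs) 2 ^ (2 * k)
         \<le> trace_mat (adjacency_matrix G vs ^\<^sub>m (2 * k)) / 2 \<and>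
         trace_mat (adjacency_matrix G vs ^\<^sub>m (2 * k)) / 2 = real (closed_walks (2 * k) G) / 2 \<and>
         (nth_eigenvalue (adjacency_matrix G vs) 1 ^ (2 * k)
            + nth_eigenvalue (adjacency_matrix G vs) 2 ^ (2 * k)
          = trace_mat (adjacency_matrix G vs ^\<^sub>m (2 * k)) / 2
          \<longleftrightarrow>
            is_blow_up G (disjoint_union (path_graph 2) (complete_graph 1)) \<or>
            is_blow_up G (disjoint_union (disjoint_copies 2 (path_graph 2)) (complete_graph 1)) \<or>
            is_blow_up G (disjoint_union (path_graph 4) (complete_graph 1)) \<or>
            is_blow_up G (disjoint_union (path_graph 5) (complete_graph 1)))"
proof -
  let ?A = "adjacency_matrix G vs" and ?n = "length vs"
  note G = \<open>pair_graph G\<close> and vs = \<open>distinct vs\<close> \<open>set vs = pverts G\<close>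
  \<comment> \<open>Indices start at 0 here, so \<open>l 0\<close> and \<open>l 1\<close> are the
    two largest eigenvalues.\<close>
  define l where "l i = eigenvalue_list ?A ! i" for i
  obtain B P Q where sim: "similar_mat_wit ?A B P Q" and ut: "upper_triangular B"
    and mset: "mset (eigenvalue_list ?A) = mset (map (\<lambda>i. B $$ (i, i)) [0..<?n])"
    using eigenvalue_list_triangular[OF adjacency_matrix_carrier adjacency_matrix_symmetric[OF G vs]] .
  have len: "length (eigenvalue_list ?A) = ?n" using mset_eq_length[OF mset] by simp
  have n: "3 \<le> ?n" using assms(1,3) distinct_card[OF vs(1)] vs(2) by simp
  have dec: "l j \<le> l i" if "i \<le> j" "j < ?n" for i j
    using sorted_rev_nth_mono[of "eigenvalue_list ?A" i j] that len
    by (simp add: l_def eigenvalue_list_def)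
  have trace: "trace_mat (?A ^\<^sub>m t) = (\<Sum>i<?n. l i ^ t)" for t
    using trace_pow_similar_triangular[OF adjacency_matrix_carrier sim ut]
      sum_nth_eq_if_mset_eq[OF mset, of "\<lambda>x. x ^ t"] by (simp add: l_def)
  have card: "card {i\<in>{..<?n}. l i \<noteq> 0} = card {i\<in>{..<?n}. B $$ (i, i) \<noteq> 0}"
    unfolding l_def by (rule card_eq_if_mset_eq[OF mset])
  \<comment> \<open>A nonzero odd trace would come from an odd closed walk of length at most
    \<open>2 * k + 1\<close>, which contains a forbidden cycle. The exponent 3 below is covered
    because \<open>k \<ge> 1\<close>.\<close>
  have odd0: "(\<Sum>i<?n. l i ^ t) = 0" if "odd t" "t \<le> 2 * k + 1" for t
    unfolding trace[symmetric] trace_adjacency_matrix_pow_eq_0_iff[OF G vs]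
    using contains_cycle_if_odd_closed_walk[OF G _ that(1)] that(2) assms(6) by fastforce
  have sum1: "(\<Sum>i<?n. l i) = 0" and sum3: "(\<Sum>i<?n. l i ^ 3) = 0"
    and sumk: "(\<Sum>i<?n. l i ^ Suc (2 * k)) = 0"
    using odd0[of 1] odd0[of 3] odd0[of "Suc (2 * k)"] \<open>k > 0\<close> by simp_all
  have nn: "0 \<le> (\<Sum>i<?n. l i ^ Suc (2 * m))" for m
    unfolding trace[symmetric] trace_adjacency_matrix_pow[OF G vs] by (rule of_nat_0_le_iff)
  note top = top_two_power_sum_le[OF n _ sum1 sum3 \<open>k > 0\<close> sumk nn]
  have top1: "l 0 ^ (2 * k) + l 1 ^ (2 * k) \<le> (\<Sum>i<?n. l i ^ (2 * k)) / 2"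
    by (rule top(1)) (rule dec)
  have top2: "l 0 ^ (2 * k) + l 1 ^ (2 * k) = (\<Sum>i<?n. l i ^ (2 * k)) / 2
      \<longleftrightarrow> card {i\<in>{..<?n}. l i \<noteq> 0} \<le> 4"
    by (rule top(2)) (rule dec)
  have four: "card {i\<in>{..<?n}. l i \<noteq> 0} \<le> 4 \<longleftrightarrow>
    (\<exists>c. \<forall>x\<in>pverts G. \<forall>y\<in>pverts G. (x, y) \<in> parcs G \<longleftrightarrow> path5_adj (c x) (c y))"
  proof
    assume le4: "card {i\<in>{..<?n}. l i \<noteq> 0} \<le> 4"
    \<comment> \<open>With at most four nonzero eigenvalues the spectrum is symmetric about 0, so
      the odd traces of every length vanish, including those beyond the excluded cycles.\<close>
    have "trace_mat (?A ^\<^sub>m t) = 0" if "odd t" for t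
      using power_sum_if_card_nonzero_le_4[OF n dec sum1 sum3 le4, of t] that
      by (simp add: trace odd_pos)
    then show "\<exists>c. \<forall>x\<in>pverts G. \<forall>y\<in>pverts G. (x, y) \<in> parcs G \<longleftrightarrow> path5_adj (c x) (c y)"
      using path5_coloring_if_four_nonzero_eigenvalues[OF G vs sim ut] le4 card by simp
  next
    assume "\<exists>c. \<forall>x\<in>pverts G. \<forall>y\<in>pverts G. (x, y) \<in> parcs G \<longleftrightarrow> path5_adj (c x) (c y)"
    then show "card {i\<in>{..<?n}. l i \<noteq> 0} \<le> 4"
      unfolding card using four_nonzero_eigenvalues_if_path5_coloring[OF G vs sim ut] by blast
  qed
  have ev: "nth_eigenvalue ?A 1 = l 0" "nth_eigenvalue ?A 2 = l 1"
    by (simp_all add: nth_eigenvalue_def l_def)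
  show ?thesis
    unfolding closed_walks_eq_trace[OF G vs] ev trace
      top2 four blow_up_of_path_unions_iff[OF parcs_subset[OF G vs]]
    by (intro conjI top1 refl)
qed

end
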